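(* Let $A$ and $B$ be Banach algebras and let $\phi: A\to B$ be a retraction, i.e. a continuous algebra homomorphism for which there exists a continuous algebra homomorphism $\psi: B\to A$ with $\phi\circ\psi=\mathrm{id}_B$. Then the following hold. (i) If $A$ is biprojective, then $B$ is biprojective. (ii) If $A$ is contractible, then $B$ is contractible. (iii) If $A$ is biflat, then $B$ is biflat.
   Context: For a Banach algebra $A$, $A\hat{\otimes}A$ is the projective tensor product with its usual Banach $A$-bimodule structure, and $\pi_A: A\hat{\otimes}A\to A$, $\pi_A(a\otimes b)=ab$, is the diagonal operator. $A$ is biprojective if it is projective as a Banach $A$-bimodule; equivalently, $\pi_A$ has a bounded $A$-bimodule right inverse. $A$ is biflat if it is flat as a Banach $A$-bimodule; equivalently, the adjoint $\pi_A^*$ has a bounded $A$-bimodule left inverse. A derivation from $A$ into a Banach $A$-bimodule $E$ is a bounded linear map $D$ with $D(ab)=D(a)b+aD(b)$; it is inner if there is $z\in E$ with $D(a)=za-az$ for all $a\in A$. $A$ is contractible if every continuous derivation from $A$ into any Banach $A$-bimodule $E$ is inner. *)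

theory Defs
  imports "HOL-Analysis.Analysis" "HOL-Library.Poly_Mapping"
begin

section \<open>Complex Banach spaces and algebras\<close>

text \<open>Banach algebras are complex; neither a unit nor nontriviality is assumed. The real structure
  inherited from \<^class>\<open>banach\<close> is the restriction of the complex one. Submultiplicativity of the
  norm is part of \<^class>\<open>real_normed_algebra\<close>.\<close>

class complex_banach = banach +
  fixes scaleC :: "complex \<Rightarrow> 'a \<Rightarrow> 'a" (infixr "*\<^sub>C" 75)
  assumes scaleC_add_right: "c *\<^sub>C (x + y) = c *\<^sub>C x + c *\<^sub>C y"
    and scaleC_add_left: "(c + d) *\<^sub>C x = c *\<^sub>C x + d *\<^sub>C x"
    and scaleC_scaleC: "c *\<^sub>C d *\<^sub>C x = (c * d) *\<^sub>C x"
    and scaleC_of_real: "complex_of_real r *\<^sub>C x = r *\<^sub>R x"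
    and norm_scaleC: "norm (c *\<^sub>C x) = cmod c * norm x"

class complex_banach_algebra = complex_banach + real_normed_algebra +
  assumes scaleC_mult_left: "(c *\<^sub>C x) * y = c *\<^sub>C (x * y)"
    and scaleC_mult_right: "x * (c *\<^sub>C y) = c *\<^sub>C (x * y)"

instantiation complex :: complex_banach_algebra
begin
definition "c *\<^sub>C (x :: complex) = c * x"
instance by standard (simp_all add: scaleC_complex_def algebra_simps norm_mult scaleR_conv_of_real)
end

lemma scaleC_one [simp]:
  fixes x y :: "'a :: complex_banach"
  shows "1 *\<^sub>C x = x"
  using scaleC_of_real[of 1 x] by simp
lemma scaleC_zero_left [simp]:
  fixes x y :: "'a :: complex_banach"
  shows "0 *\<^sub>C x = 0"
  using scaleC_of_real[of 0 x] by simp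
lemma scaleC_zero_right [simp]:
  fixes x y :: "'a :: complex_banach"
  shows "c *\<^sub>C 0 = 0"
  using scaleC_add_right[of c 0 0] by simp
lemma scaleC_minus_right:
  fixes x y :: "'a :: complex_banach"
  shows "c *\<^sub>C (- x) = - (c *\<^sub>C x)"
  using scaleC_add_right[of c x "- x"] by (simp add: eq_neg_iff_add_eq_0 add.commute)
lemma scaleC_minus_one:
  fixes x y :: "'a :: complex_banach"
  shows "(-1) *\<^sub>C x = - x"
  using scaleC_of_real[of "-1" x] by simp
lemma scaleC_diff_right:
  fixes x y :: "'a :: complex_banach"
  shows "c *\<^sub>C (x - y) = c *\<^sub>C x - c *\<^sub>C y"
  using scaleC_add_right[of c x "- y"] scaleC_minus_right[of c y] by simp
lemma scaleC_sum_right: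
  fixes f :: "'i \<Rightarrow> 'a :: complex_banach"
  shows "c *\<^sub>C (\<Sum>i\<in>I. f i) = (\<Sum>i\<in>I. c *\<^sub>C f i)"
  by (induction I rule: infinite_finite_induct) (simp_all add: scaleC_add_right)

lemma bounded_linear_scaleC: "bounded_linear (\<lambda>x :: 'a :: complex_banach. c *\<^sub>C x)"
proof (rule bounded_linear_intro[where K = "cmod c"])
  fix r and x :: 'a
  show "c *\<^sub>C r *\<^sub>R x = r *\<^sub>R c *\<^sub>C x"
    by (simp add: scaleC_of_real[symmetric] scaleC_scaleC mult.commute)
qed (simp_all add: scaleC_add_right norm_scaleC)

definition bounded_clinear :: "('a :: complex_banach \<Rightarrow> 'b :: complex_banach) \<Rightarrow> bool" where
  "bounded_clinear f \<longleftrightarrow> bounded_linear f \<and> (\<forall>c x. f (c *\<^sub>C x) = c *\<^sub>C f x)"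

definition bounded_cbilinear ::
    "('a :: complex_banach \<Rightarrow> 'b :: complex_banach \<Rightarrow> 'c :: complex_banach) \<Rightarrow> bool" where
  "bounded_cbilinear f \<longleftrightarrow> bounded_bilinear f \<and>
     (\<forall>c a b. f (c *\<^sub>C a) b = c *\<^sub>C f a b) \<and> (\<forall>c a b. f a (c *\<^sub>C b) = c *\<^sub>C f a b)"

section \<open>The dual space\<close>

typedef (overloaded) 'a dual = "{f :: 'a :: complex_banach \<Rightarrow> complex. bounded_clinear f}"
  morphisms dual_apply Abs_dual
  by (rule exI[of _ "\<lambda>_. 0"]) (simp add: bounded_clinear_def)

setup_lifting type_definition_dual

instantiation dual :: (complex_banach) real_normed_vector
begin
lift_definition zero_dual :: "'a dual" is "\<lambda>_. 0" by (simp add: bounded_clinear_def)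
lift_definition plus_dual :: "'a dual \<Rightarrow> 'a dual \<Rightarrow> 'a dual" is "\<lambda>f g x. f x + g x"
  by (simp add: bounded_clinear_def bounded_linear_add scaleC_add_right)
lift_definition minus_dual :: "'a dual \<Rightarrow> 'a dual \<Rightarrow> 'a dual" is "\<lambda>f g x. f x - g x"
  by (simp add: bounded_clinear_def bounded_linear_sub scaleC_diff_right)
lift_definition uminus_dual :: "'a dual \<Rightarrow> 'a dual" is "\<lambda>f x. - f x"
  by (simp add: bounded_clinear_def bounded_linear_minus scaleC_minus_right)
lift_definition scaleR_dual :: "real \<Rightarrow> 'a dual \<Rightarrow> 'a dual" is "\<lambda>r f x. r *\<^sub>R f x"
  by (auto simp add: bounded_clinear_def scaleC_complex_def
      intro: bounded_linear_compose[OF bounded_linear_scaleR_right])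
lift_definition norm_dual :: "'a dual \<Rightarrow> real" is onorm .
definition "dist_dual (f :: 'a dual) g = norm (f - g)"
definition "sgn_dual (f :: 'a dual) = scaleR (inverse (norm f)) f"
definition "(uniformity :: ('a dual \<times> 'a dual) filter) =
  (INF e\<in>{0<..}. principal {(f, g). dist f g < e})"
definition "open (S :: 'a dual set) \<longleftrightarrow>
  (\<forall>f\<in>S. \<forall>\<^sub>F (f', g) in uniformity. f' = f \<longrightarrow> g \<in> S)"
instance
  apply standard
  unfolding dist_dual_def open_dual_def sgn_dual_def uniformity_dual_def
  apply (rule refl | (transfer, force simp: bounded_clinear_def onorm_triangle onorm_scaleR onorm_eq_0 algebra_simps))+
  done
end

lemma bounded_clinear_dual_apply: "bounded_clinear (dual_apply f)"
  using dual_apply[of f] by simp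

lift_definition dual_blinfun :: "'a :: complex_banach dual \<Rightarrow> 'a \<Rightarrow>\<^sub>L complex" is "\<lambda>f. f"
  by (simp add: bounded_clinear_def)

lemma dual_blinfun_diff: "dual_blinfun (f - g) = dual_blinfun f - dual_blinfun g"
  by transfer simp

lemma norm_dual_blinfun: "norm (dual_blinfun f) = norm f"
  by transfer simp

lemma range_dual_blinfun:
  "range (dual_blinfun :: 'a :: complex_banach dual \<Rightarrow> _) = {F. \<forall>c x. blinfun_apply F (c *\<^sub>C x) = c * blinfun_apply F x}"
proof safe
  fix f :: "'a dual" and c x
  show "blinfun_apply (dual_blinfun f) (c *\<^sub>C x) = c * blinfun_apply (dual_blinfun f) x"
    by transfer (simp add: bounded_clinear_def scaleC_complex_def)
next
  fix F :: "'a \<Rightarrow>\<^sub>L complex"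
  assume "\<forall>c x. blinfun_apply F (c *\<^sub>C x) = c * blinfun_apply F x"
  then have "bounded_clinear (blinfun_apply F)"
    by (simp add: bounded_clinear_def scaleC_complex_def blinfun.bounded_linear_right)
  then have "dual_blinfun (Abs_dual (blinfun_apply F)) = F"
    by (intro blinfun_eqI) (simp add: dual_blinfun.rep_eq Abs_dual_inverse)
  then show "F \<in> range dual_blinfun" by (rule range_eqI[OF sym])
qed

instantiation dual :: (complex_banach) complex_banach
begin
lift_definition scaleC_dual :: "complex \<Rightarrow> 'a dual \<Rightarrow> 'a dual" is "\<lambda>c f x. c * f x"
  by (auto simp add: bounded_clinear_def scaleC_complex_def
      intro: bounded_linear_compose[OF bounded_linear_mult_right])
instance
proof
  fix X :: "nat \<Rightarrow> 'a dual"
  assume X: "Cauchy X"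
  have "Cauchy (\<lambda>n. dual_blinfun (X n))"
    using X by (simp add: Cauchy_def dist_norm dual_blinfun_diff[symmetric] norm_dual_blinfun)
  then obtain F where F: "(\<lambda>n. dual_blinfun (X n)) \<longlonglongrightarrow> F"
    using Cauchy_convergent convergent_def by blast
  have lim: "(\<lambda>n. dual_blinfun (X n) x) \<longlonglongrightarrow> F x" for x
    using F by (intro tendsto_intros)
  have "blinfun_apply F (c *\<^sub>C x) = c * blinfun_apply F x" for c x
  proof (rule LIMSEQ_unique[OF lim])
    have "dual_blinfun (X n) \<in> range dual_blinfun" for n by (rule rangeI)
    then have "blinfun_apply (dual_blinfun (X n)) (c *\<^sub>C x) = c * blinfun_apply (dual_blinfun (X n)) x" for n
      unfolding range_dual_blinfun by simp
    then show "(\<lambda>n. blinfun_apply (dual_blinfun (X n)) (c *\<^sub>C x)) \<longlonglongrightarrow> c * blinfun_apply F x"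
      by (simp add: tendsto_mult_left lim)
  qed
  then have "F \<in> range dual_blinfun" by (simp add: range_dual_blinfun)
  then obtain f where f: "F = dual_blinfun f" by blast
  have "X \<longlonglongrightarrow> f"
    using F unfolding f by (simp add: LIMSEQ_iff dual_blinfun_diff[symmetric] norm_dual_blinfun)
  then show "convergent X" by (auto simp: convergent_def)
next
  fix c :: complex and f :: "'a dual"
  show "norm (c *\<^sub>C f) = cmod c * norm f"
  proof (transfer fixing: c)
    fix f :: "'a \<Rightarrow> complex"
    assume "bounded_clinear f"
    then have f: "bounded_linear f" by (simp add: bounded_clinear_def)
    have le: "onorm (\<lambda>x. c * g x) \<le> cmod c * onorm g" if "bounded_linear g" for c and g :: "'a \<Rightarrow> complex"
      using onorm[OF that]
      by (intro onorm_bound) (auto simp: norm_mult mult.assoc onorm_pos_le[OF that] intro!: mult_left_mono)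
    show "onorm (\<lambda>x. c * f x) = cmod c * onorm f"
    proof (cases "c = 0")
      case True then show ?thesis by (simp add: onorm_zero)
    next
      case False
      have "onorm (\<lambda>x. inverse c * (c * f x)) \<le> cmod (inverse c) * onorm (\<lambda>x. c * f x)"
        by (intro le bounded_linear_compose[OF bounded_linear_mult_right f])
      then have "cmod c * onorm f \<le> onorm (\<lambda>x. c * f x)"
        using False by (simp add: mult.assoc[symmetric] norm_inverse norm_divide field_simps)
      then show ?thesis using le[OF f, of c] by simp
    qed
  qed
qed (transfer, simp add: algebra_simps scaleR_conv_of_real)+
end

definition adjoint_map :: "('a :: complex_banach \<Rightarrow> 'b :: complex_banach) \<Rightarrow> 'b dual \<Rightarrow> 'a dual" where
  "adjoint_map T f = Abs_dual (\<lambda>x. dual_apply f (T x))"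

lemma dual_apply_adjoint_map:
  assumes "bounded_clinear T"
  shows "dual_apply (adjoint_map T f) x = dual_apply f (T x)"
proof -
  have "bounded_clinear (\<lambda>x. dual_apply f (T x))"
    using assms bounded_clinear_dual_apply[of f] bounded_linear_compose
    by (auto simp: bounded_clinear_def)
  then show ?thesis by (simp add: adjoint_map_def Abs_dual_inverse)
qed

section \<open>The algebraic tensor product and the projective norm\<close>

text \<open>The algebraic tensor product is the quotient of the free complex vector space on
  \<open>'a \<times> 'b\<close> by the subspace spanned by the bilinearity relations.\<close>

abbreviation fscale :: "complex \<Rightarrow> ('k \<Rightarrow>\<^sub>0 complex) \<Rightarrow> ('k \<Rightarrow>\<^sub>0 complex)" where
  "fscale c \<equiv> Poly_Mapping.map ((*) c)"

abbreviation fbasis :: "'a \<Rightarrow> 'b \<Rightarrow> ('a \<times> 'b) \<Rightarrow>\<^sub>0 complex" where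
  "fbasis a b \<equiv> Poly_Mapping.single (a, b) 1"

inductive_set bilinear_relations ::
    "(('a :: complex_banach \<times> 'b :: complex_banach) \<Rightarrow>\<^sub>0 complex) set" where
  add_left: "fbasis (a + a') b - fbasis a b - fbasis a' b \<in> bilinear_relations"
| add_right: "fbasis a (b + b') - fbasis a b - fbasis a b' \<in> bilinear_relations"
| scale_left: "fbasis (c *\<^sub>C a) b - fscale c (fbasis a b) \<in> bilinear_relations"
| scale_right: "fbasis a (c *\<^sub>C b) - fscale c (fbasis a b) \<in> bilinear_relations"
| zero: "0 \<in> bilinear_relations"
| plus: "u \<in> bilinear_relations \<Longrightarrow> v \<in> bilinear_relations \<Longrightarrow> u + v \<in> bilinear_relations"
| scale: "u \<in> bilinear_relations \<Longrightarrow> fscale c u \<in> bilinear_relations"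

lemma lookup_fscale [simp]: "Poly_Mapping.lookup (fscale c u) k = c * Poly_Mapping.lookup u k"
  by (simp add: Poly_Mapping.map.rep_eq when_def)

lemma fscale_minus_one: "fscale (-1) u = - u"
  by (rule poly_mapping_eqI) simp

lemma fscale_add: "fscale c (u + v) = fscale c u + fscale c v"
  by (rule poly_mapping_eqI) (simp add: lookup_add algebra_simps)

lemma fscale_diff: "fscale c (u - v) = fscale c u - fscale c v"
  by (rule poly_mapping_eqI) (simp add: lookup_minus algebra_simps)

lemma bilinear_relations_uminus: "u \<in> bilinear_relations \<Longrightarrow> - u \<in> bilinear_relations"
  using bilinear_relations.scale[of u "-1"] by (simp only: fscale_minus_one)

lemma bilinear_relations_diff:
  "u \<in> bilinear_relations \<Longrightarrow> v \<in> bilinear_relations \<Longrightarrow> u - v \<in> bilinear_relations"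
  using bilinear_relations.plus[OF _ bilinear_relations_uminus, of u v] by simp

quotient_type (overloaded) ('a, 'b) atensor =
    "('a :: complex_banach \<times> 'b :: complex_banach) \<Rightarrow>\<^sub>0 complex" / "\<lambda>u v. u - v \<in> bilinear_relations"
proof (rule equivpI)
  show "reflp (\<lambda>u v :: ('a \<times> 'b) \<Rightarrow>\<^sub>0 complex. u - v \<in> bilinear_relations)"
    by (rule reflpI) (simp add: bilinear_relations.zero)
  show "symp (\<lambda>u v :: ('a \<times> 'b) \<Rightarrow>\<^sub>0 complex. u - v \<in> bilinear_relations)"
    by (rule sympI) (use bilinear_relations_uminus in force)
  show "transp (\<lambda>u v :: ('a \<times> 'b) \<Rightarrow>\<^sub>0 complex. u - v \<in> bilinear_relations)"
    by (rule transpI) (use bilinear_relations.plus in force)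
qed

instantiation atensor :: (complex_banach, complex_banach) ab_group_add
begin
lift_definition zero_atensor :: "('a, 'b) atensor" is 0 .
lift_definition plus_atensor :: "('a, 'b) atensor \<Rightarrow> ('a, 'b) atensor \<Rightarrow> ('a, 'b) atensor" is "(+)"
  by (simp only: add_diff_add bilinear_relations.plus)
lift_definition uminus_atensor :: "('a, 'b) atensor \<Rightarrow> ('a, 'b) atensor" is uminus
  by (simp only: minus_diff_minus bilinear_relations_uminus)
lift_definition minus_atensor :: "('a, 'b) atensor \<Rightarrow> ('a, 'b) atensor \<Rightarrow> ('a, 'b) atensor" is "(-)"
proof -
  fix u u' v v' :: "('a \<times> 'b) \<Rightarrow>\<^sub>0 complex"
  assume "u - u' \<in> bilinear_relations" "v - v' \<in> bilinear_relations"
  then have "(u - u') - (v - v') \<in> bilinear_relations" by (rule bilinear_relations_diff)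
  then show "u - v - (u' - v') \<in> bilinear_relations" by (simp add: algebra_simps)
qed
instance
  by standard (transfer, simp add: algebra_simps bilinear_relations.zero)+
end

lift_definition atensor_scale :: "complex \<Rightarrow> ('a :: complex_banach, 'b :: complex_banach) atensor \<Rightarrow> ('a, 'b) atensor"
  is fscale
  by (simp only: fscale_diff[symmetric] bilinear_relations.scale)

lift_definition atens :: "'a :: complex_banach \<Rightarrow> 'b :: complex_banach \<Rightarrow> ('a, 'b) atensor" is fbasis .

lemma atens_add_left: "atens (a + a') b = atens a b + atens a' b"
  by transfer (simp only: diff_diff_eq[symmetric] bilinear_relations.add_left)

lemma atens_add_right: "atens a (b + b') = atens a b + atens a b'"
  by transfer (simp only: diff_diff_eq[symmetric] bilinear_relations.add_right)

lemma atens_scale_left: "atens (c *\<^sub>C a) b = atensor_scale c (atens a b)"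
  by transfer (rule bilinear_relations.scale_left)

lemma atens_scale_right: "atens a (c *\<^sub>C b) = atensor_scale c (atens a b)"
  by transfer (rule bilinear_relations.scale_right)

lemma atensor_scale_add: "atensor_scale c (s + t) = atensor_scale c s + atensor_scale c t"
  by transfer (simp add: fscale_add bilinear_relations.zero)

lemma atensor_scale_add_left: "atensor_scale (c + d) t = atensor_scale c t + atensor_scale d t"
proof (transfer fixing: c d)
  fix t :: "('a \<times> 'b) \<Rightarrow>\<^sub>0 complex"
  have "fscale (c + d) t = fscale c t + fscale d t"
    by (rule poly_mapping_eqI) (simp add: lookup_add algebra_simps)
  then show "fscale (c + d) t - (fscale c t + fscale d t) \<in> bilinear_relations"
    by (simp add: bilinear_relations.zero)
qed

lemma atensor_scale_scale: "atensor_scale c (atensor_scale d t) = atensor_scale (c * d) t"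
proof (transfer fixing: c d)
  fix t :: "('a \<times> 'b) \<Rightarrow>\<^sub>0 complex"
  have "fscale c (fscale d t) = fscale (c * d) t"
    by (rule poly_mapping_eqI) (simp add: algebra_simps)
  then show "fscale c (fscale d t) - fscale (c * d) t \<in> bilinear_relations"
    by (simp add: bilinear_relations.zero)
qed

lemma atensor_scale_one: "atensor_scale 1 t = t"
proof transfer
  fix t :: "('a \<times> 'b) \<Rightarrow>\<^sub>0 complex"
  have "fscale 1 t = t"
    by (rule poly_mapping_eqI) simp
  then show "fscale 1 t - t \<in> bilinear_relations"
    by (simp add: bilinear_relations.zero)
qed

lemma atensor_scale_zero [simp]: "atensor_scale c 0 = 0"
  using atensor_scale_add[of c 0 0] by simp

lemma atensor_scale_zero_left [simp]: "atensor_scale 0 t = 0"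
  using atensor_scale_add_left[of 0 0 t] by simp

lemma atensor_scale_minus_one: "atensor_scale (-1) t = - t"
  using atensor_scale_add_left[of "-1" 1 t] by (simp add: atensor_scale_one eq_neg_iff_add_eq_0)

lemma atensor_scale_diff: "atensor_scale c (s - t) = atensor_scale c s - atensor_scale c t"
  using atensor_scale_add[of c "s - t" t] by (simp add: algebra_simps)

definition atensor_sum :: "('a :: complex_banach \<times> 'b :: complex_banach) list \<Rightarrow> ('a, 'b) atensor" where
  "atensor_sum xs = (\<Sum>(a, b)\<leftarrow>xs. atens a b)"

lemma atensor_sum_simps [simp]:
  "atensor_sum [] = 0"
  "atensor_sum ((a, b) # xs) = atens a b + atensor_sum xs"
  "atensor_sum (xs @ ys) = atensor_sum xs + atensor_sum ys"
  by (simp_all add: atensor_sum_def)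

lemma atensor_sum_scale:
  "atensor_scale c (atensor_sum xs) = atensor_sum (map (\<lambda>(a, b). (c *\<^sub>C a, b)) xs)"
  by (induction xs) (auto simp: atensor_scale_add atens_scale_left)

lemma atensor_sum_exhaust: obtains xs where "t = atensor_sum xs"
proof -
  have rep: "\<exists>xs. abs_atensor (\<Sum>k\<in>S. Poly_Mapping.single k (c k)) = atensor_sum xs"
    if "finite S" for S :: "('a \<times> 'b) set" and c
    using that
  proof induction
    case empty
    have "abs_atensor (\<Sum>k\<in>{}. Poly_Mapping.single k (c k)) = atensor_sum ([] :: ('a \<times> 'b) list)"
      by (simp add: zero_atensor_def)
    then show ?case by blast
  next
    case (insert k S)
    then obtain xs where xs: "abs_atensor (\<Sum>k\<in>S. Poly_Mapping.single k (c k)) = atensor_sum xs" by blast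
    obtain a b where k: "k = (a, b)" by force
    have "abs_atensor (Poly_Mapping.single k (c k)) = atensor_scale (c k) (atens a b)"
      by (simp add: k atens.abs_eq atensor_scale.abs_eq)
    then have "abs_atensor (\<Sum>k\<in>insert k S. Poly_Mapping.single k (c k)) = atensor_sum ((c k *\<^sub>C a, b) # xs)"
      using insert.hyps by (simp add: plus_atensor.abs_eq[symmetric] xs atens_scale_left)
    then show ?case by blast
  qed
  have expand: "u = (\<Sum>k\<in>Poly_Mapping.keys u. Poly_Mapping.single k (Poly_Mapping.lookup u k))"
    for u :: "('a \<times> 'b) \<Rightarrow>\<^sub>0 complex"
    by (rule poly_mapping_eqI) (simp add: lookup_sum lookup_single when_def in_keys_iff)
  define u where "u = rep_atensor t"
  have "t = abs_atensor u"
    unfolding u_def by (rule Quotient_abs_rep[OF Quotient_atensor, symmetric])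
  then have "t = abs_atensor (\<Sum>k\<in>Poly_Mapping.keys u. Poly_Mapping.single k (Poly_Mapping.lookup u k))"
    by (simp only: expand[symmetric])
  with rep[of "Poly_Mapping.keys u" "Poly_Mapping.lookup u"] that show ?thesis by auto
qed

text \<open>Scalars are absorbed into the left factors, so sums of elementary tensors exhaust the
  algebraic tensor product.\<close>

definition proj_norm :: "('a :: complex_banach, 'b :: complex_banach) atensor \<Rightarrow> real" where
  "proj_norm t = Inf {\<Sum>(a, b)\<leftarrow>xs. norm a * norm b | xs. t = (\<Sum>(a, b)\<leftarrow>xs. atens a b)}"

abbreviation (input) lnorm :: "('a :: complex_banach \<times> 'b :: complex_banach) list \<Rightarrow> real" where
  "lnorm xs \<equiv> (\<Sum>(a, b)\<leftarrow>xs. norm a * norm b)"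

lemma lnorm_ge0: "0 \<le> lnorm xs"
  by (induction xs) auto

lemma proj_norm_le: "proj_norm (atensor_sum xs) \<le> lnorm xs"
  unfolding proj_norm_def atensor_sum_def
  by (rule cInf_lower) (auto intro!: bdd_belowI[of _ 0] lnorm_ge0)

lemma proj_norm_approx:
  assumes "e > 0"
  obtains xs where "t = atensor_sum xs" "lnorm xs < proj_norm t + e"
proof -
  obtain ys where "t = atensor_sum ys" by (rule atensor_sum_exhaust)
  then have "{lnorm xs | xs. t = (\<Sum>(a, b)\<leftarrow>xs. atens a b)} \<noteq> {}"
    by (auto simp: atensor_sum_def)
  from cInf_lessD[OF this, of "proj_norm t + e"] assms that show ?thesis
    by (auto simp: proj_norm_def atensor_sum_def)
qed

lemma proj_norm_ge0: "0 \<le> proj_norm t"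
proof (rule field_le_epsilon)
  fix e :: real assume "0 < e"
  then obtain xs where "t = atensor_sum xs" "lnorm xs < proj_norm t + e" by (rule proj_norm_approx)
  with lnorm_ge0[of xs] show "0 \<le> proj_norm t + e" by linarith
qed

lemma proj_norm_triangle: "proj_norm (s + t) \<le> proj_norm s + proj_norm t"
proof (rule field_le_epsilon)
  fix e :: real assume "0 < e"
  then have e: "0 < e / 2" by simp
  obtain xs where xs: "s = atensor_sum xs" "lnorm xs < proj_norm s + e / 2" using e by (rule proj_norm_approx)
  obtain ys where ys: "t = atensor_sum ys" "lnorm ys < proj_norm t + e / 2" using e by (rule proj_norm_approx)
  show "proj_norm (s + t) \<le> proj_norm s + proj_norm t + e"
    using proj_norm_le[of "xs @ ys"] xs ys by simp
qed

lemma proj_norm_zero [simp]: "proj_norm (0 :: ('a :: complex_banach, 'b :: complex_banach) atensor) = 0"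
  using proj_norm_le[of "[] :: ('a \<times> 'b) list"] proj_norm_ge0[of "0 :: ('a, 'b) atensor"] by simp

lemma proj_norm_scale_le: "proj_norm (atensor_scale c t) \<le> cmod c * proj_norm t"
proof (cases "c = 0")
  case True
  then show ?thesis by simp
next
  case False
  show ?thesis
  proof (rule field_le_epsilon)
    fix e :: real assume "0 < e"
    then have e: "0 < e / cmod c" using False by simp
    obtain xs where xs: "t = atensor_sum xs" "lnorm xs < proj_norm t + e / cmod c"
      using e by (rule proj_norm_approx)
    have "lnorm (map (\<lambda>(a, b). (c *\<^sub>C a, b)) xs) = cmod c * lnorm xs"
      by (induction xs) (auto simp: norm_scaleC algebra_simps)
    moreover have "cmod c * lnorm xs \<le> cmod c * (proj_norm t + e / cmod c)"
      using xs(2) by (intro mult_left_mono) auto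
    ultimately show "proj_norm (atensor_scale c t) \<le> cmod c * proj_norm t + e"
      using proj_norm_le[of "map (\<lambda>(a, b). (c *\<^sub>C a, b)) xs"] False
      by (simp add: xs(1) atensor_sum_scale distrib_left)
  qed
qed

lemma proj_norm_scale: "proj_norm (atensor_scale c t) = cmod c * proj_norm t"
proof (cases "c = 0")
  case False
  have "proj_norm t \<le> cmod (inverse c) * proj_norm (atensor_scale c t)"
    using proj_norm_scale_le[of "inverse c" "atensor_scale c t"] False
    by (simp add: atensor_scale_scale atensor_scale_one)
  then have "cmod c * proj_norm t \<le> proj_norm (atensor_scale c t)"
    using False by (simp add: norm_inverse norm_divide field_simps)
  with proj_norm_scale_le[of c t] show ?thesis by linarith
qed simp

lemma proj_norm_uminus [simp]: "proj_norm (- t) = proj_norm t"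
  using proj_norm_scale[of "-1" t] by (simp add: atensor_scale_minus_one)

lemma proj_norm_minus_commute: "proj_norm (s - t) = proj_norm (t - s)"
  using proj_norm_uminus[of "s - t"] by simp

lemma proj_norm_diff_triangle: "proj_norm (r - t) \<le> proj_norm (r - s) + proj_norm (s - t)"
  using proj_norm_triangle[of "r - s" "s - t"] by simp

lemma proj_norm_abs_diff: "\<bar>proj_norm s - proj_norm t\<bar> \<le> proj_norm (s - t)"
  using proj_norm_triangle[of "s - t" t] proj_norm_triangle[of "t - s" s]
  by (simp add: proj_norm_minus_commute[of t s] abs_le_iff)

lemma proj_norm_atens: "proj_norm (atens a b) \<le> norm a * norm b"
  using proj_norm_le[of "[(a, b)]"] by simp

subsection \<open>Linear maps induced by bilinear maps\<close>

definition flift :: "('a \<Rightarrow> 'b \<Rightarrow> 'c :: complex_banach) \<Rightarrow> (('a \<times> 'b) \<Rightarrow>\<^sub>0 complex) \<Rightarrow> 'c" where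
  "flift f u = (\<Sum>k\<in>Poly_Mapping.keys u. Poly_Mapping.lookup u k *\<^sub>C f (fst k) (snd k))"

lemma flift_superset:
  assumes "finite S" "Poly_Mapping.keys u \<subseteq> S"
  shows "flift f u = (\<Sum>k\<in>S. Poly_Mapping.lookup u k *\<^sub>C f (fst k) (snd k))"
  unfolding flift_def
  using assms by (intro sum.mono_neutral_left) (auto simp: in_keys_iff)

lemma flift_add: "flift f (u + v) = flift f u + flift f v"
proof -
  let ?S = "Poly_Mapping.keys u \<union> Poly_Mapping.keys v"
  have "Poly_Mapping.keys (u + v) \<subseteq> ?S" by (rule Poly_Mapping.keys_add)
  then show ?thesis
    by (simp add: flift_superset[of ?S] lookup_add scaleC_add_left sum.distrib)
qed

lemma flift_scale: "flift f (fscale c u) = c *\<^sub>C flift f u"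
proof -
  let ?S = "Poly_Mapping.keys u"
  have "Poly_Mapping.keys (fscale c u) \<subseteq> ?S" by (auto simp: in_keys_iff)
  then show ?thesis
    by (simp add: flift_superset[of ?S] scaleC_sum_right scaleC_scaleC)
qed

lemma flift_diff: "flift f (u - v) = flift f u - flift f v"
  using flift_add[of f "u - v" v] by (simp add: algebra_simps)

lemma flift_basis [simp]: "flift f (fbasis a b) = f a b"
  by (simp add: flift_def)

lemma flift_relations:
  assumes "bounded_cbilinear f" "u \<in> bilinear_relations"
  shows "flift f u = 0"
proof -
  interpret bounded_bilinear f using assms(1) by (simp add: bounded_cbilinear_def)
  show ?thesis
    using assms(2)
    by induction
      (use assms(1) in \<open>simp_all add: flift_add flift_scale flift_diff add_left add_right bounded_cbilinear_def del: map_single\<close>,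
       simp add: flift_def)
qed

definition alift :: "('a :: complex_banach \<Rightarrow> 'b :: complex_banach \<Rightarrow> 'c :: complex_banach) \<Rightarrow> ('a, 'b) atensor \<Rightarrow> 'c" where
  "alift f t = flift f (rep_atensor t)"

lemma alift_abs:
  assumes "bounded_cbilinear f"
  shows "alift f (abs_atensor u) = flift f u"
proof -
  have "rep_atensor (abs_atensor u) - u \<in> bilinear_relations"
    by (rule Quotient3_rep_abs[OF Quotient3_atensor]) (simp add: bilinear_relations.zero)
  from flift_relations[OF assms this] show ?thesis
    by (simp add: alift_def flift_diff)
qed

lemma alift_add: "bounded_cbilinear f \<Longrightarrow> alift f (s + t) = alift f s + alift f t"
proof -
  assume f: "bounded_cbilinear f"
  have "abs_atensor (rep_atensor s + rep_atensor t) = s + t"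
    by (simp only: plus_atensor.abs_eq[symmetric] Quotient_abs_rep[OF Quotient_atensor])
  then show ?thesis using alift_abs[OF f, of "rep_atensor s + rep_atensor t"]
    by (simp add: flift_add alift_def)
qed

lemma alift_scale: "bounded_cbilinear f \<Longrightarrow> alift f (atensor_scale c t) = c *\<^sub>C alift f t"
proof -
  assume f: "bounded_cbilinear f"
  have "abs_atensor (fscale c (rep_atensor t)) = atensor_scale c t"
    by (simp only: atensor_scale.abs_eq[symmetric] Quotient_abs_rep[OF Quotient_atensor])
  then show ?thesis using alift_abs[OF f, of "fscale c (rep_atensor t)"]
    by (simp add: flift_scale alift_def)
qed

lemma alift_atens: "bounded_cbilinear f \<Longrightarrow> alift f (atens a b) = f a b"
  by (simp add: atens.abs_eq alift_abs)

lemma alift_diff: "bounded_cbilinear f \<Longrightarrow> alift f (s - t) = alift f s - alift f t"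
  using alift_add[of f "s - t" t] by (simp add: algebra_simps)

lemma alift_bound:
  assumes f: "bounded_cbilinear f" and K: "\<And>a b. norm (f a b) \<le> norm a * norm b * K" "K \<ge> 0"
  shows "norm (alift f t) \<le> proj_norm t * K"
proof -
  have le: "norm (alift f (atensor_sum xs)) \<le> lnorm xs * K" for xs
  proof (induction xs)
    case Nil
    show ?case using alift_diff[OF f, of 0 0] by simp
  next
    case (Cons x xs)
    obtain a b where x: "x = (a, b)" by force
    show ?case
      using Cons K(1)[of a b] norm_triangle_ineq[of "f a b" "alift f (atensor_sum xs)"]
      by (simp add: x alift_add[OF f] alift_atens[OF f] distrib_right)
  qed
  show ?thesis
  proof (rule field_le_epsilon)
    fix e :: real assume e: "0 < e"
    obtain xs where xs: "t = atensor_sum xs" "lnorm xs < proj_norm t + e / (K + 1)"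
      by (rule proj_norm_approx[of "e / (K + 1)" t]) (use e K(2) in auto)
    have "norm (alift f t) \<le> (proj_norm t + e / (K + 1)) * K"
      using le[of xs] xs K(2) mult_right_mono[of "lnorm xs" "proj_norm t + e / (K + 1)" K] by simp
    also have "\<dots> \<le> proj_norm t * K + e"
      using K(2) e by (simp add: field_simps)
    finally show "norm (alift f t) \<le> proj_norm t * K + e" .
  qed
qed

section \<open>The projective tensor product\<close>

text \<open>The completion of the algebraic tensor product with respect to \<^const>\<open>proj_norm\<close>: Cauchy
  sequences modulo null sequences. Definiteness of \<^const>\<open>proj_norm\<close> is not needed for this
  construction (Cauchy sequences at distance zero are identified anyway).\<close>

lifting_forget atensor.lifting

definition proj_Cauchy :: "(nat \<Rightarrow> ('a :: complex_banach, 'b :: complex_banach) atensor) \<Rightarrow> bool" where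
  "proj_Cauchy X \<longleftrightarrow> (\<forall>e>0. \<exists>N. \<forall>m\<ge>N. \<forall>n\<ge>N. proj_norm (X m - X n) < e)"

definition ptensor_rel ::
    "(nat \<Rightarrow> ('a :: complex_banach, 'b :: complex_banach) atensor) \<Rightarrow> (nat \<Rightarrow> ('a, 'b) atensor) \<Rightarrow> bool" where
  "ptensor_rel X Y \<longleftrightarrow> proj_Cauchy X \<and> proj_Cauchy Y \<and> (\<lambda>n. proj_norm (X n - Y n)) \<longlonglongrightarrow> 0"

lemma proj_Cauchy_const [simp]: "proj_Cauchy (\<lambda>_. t)"
  by (simp add: proj_Cauchy_def)

lemma proj_Cauchy_add:
  assumes "proj_Cauchy X" "proj_Cauchy Y"
  shows "proj_Cauchy (\<lambda>n. X n + Y n)"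
  unfolding proj_Cauchy_def
proof (intro allI impI)
  fix e :: real assume "0 < e"
  then have e: "0 < e / 2" by simp
  obtain M where M: "\<And>m n. m \<ge> M \<Longrightarrow> n \<ge> M \<Longrightarrow> proj_norm (X m - X n) < e / 2"
    using assms(1) e unfolding proj_Cauchy_def by blast
  obtain N where N: "\<And>m n. m \<ge> N \<Longrightarrow> n \<ge> N \<Longrightarrow> proj_norm (Y m - Y n) < e / 2"
    using assms(2) e unfolding proj_Cauchy_def by blast
  have "proj_norm (X m + Y m - (X n + Y n)) < e" if "m \<ge> max M N" "n \<ge> max M N" for m n
    using proj_norm_triangle[of "X m - X n" "Y m - Y n"] M[of m n] N[of m n] that
    by (simp add: algebra_simps)
  then show "\<exists>N. \<forall>m\<ge>N. \<forall>n\<ge>N. proj_norm (X m + Y m - (X n + Y n)) < e" by blast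
qed

lemma proj_Cauchy_scale:
  assumes "proj_Cauchy X"
  shows "proj_Cauchy (\<lambda>n. atensor_scale c (X n))"
  unfolding proj_Cauchy_def
proof (intro allI impI)
  fix e :: real assume "0 < e"
  then have e: "0 < e / (cmod c + 1)" by (simp add: add_nonneg_pos)
  obtain N where N: "\<And>m n. m \<ge> N \<Longrightarrow> n \<ge> N \<Longrightarrow> proj_norm (X m - X n) < e / (cmod c + 1)"
    using assms(1) e unfolding proj_Cauchy_def by blast
  have "proj_norm (atensor_scale c (X m) - atensor_scale c (X n)) < e" if "m \<ge> N" "n \<ge> N" for m n
  proof -
    have "proj_norm (atensor_scale c (X m) - atensor_scale c (X n)) = cmod c * proj_norm (X m - X n)"
      by (simp add: atensor_scale_diff[symmetric] proj_norm_scale)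
    also have "\<dots> \<le> (cmod c + 1) * proj_norm (X m - X n)"
      by (intro mult_right_mono proj_norm_ge0) simp
    also have "\<dots> < e"
      using N[OF that] by (simp add: pos_less_divide_eq add_nonneg_pos mult.commute)
    finally show ?thesis .
  qed
  then show "\<exists>N. \<forall>m\<ge>N. \<forall>n\<ge>N. proj_norm (atensor_scale c (X m) - atensor_scale c (X n)) < e" by blast
qed

lemma proj_Cauchy_uminus: "proj_Cauchy X \<Longrightarrow> proj_Cauchy (\<lambda>n. - X n)"
  using proj_Cauchy_scale[of X "-1"] by (simp add: atensor_scale_minus_one)

lemma proj_Cauchy_diff: "proj_Cauchy X \<Longrightarrow> proj_Cauchy Y \<Longrightarrow> proj_Cauchy (\<lambda>n. X n - Y n)"
  using proj_Cauchy_add[of X "\<lambda>n. - Y n"] by (simp add: proj_Cauchy_uminus)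

lemma proj_Cauchy_convergent:
  assumes "proj_Cauchy X"
  shows "convergent (\<lambda>n. proj_norm (X n))"
proof (rule real_Cauchy_convergent)
  show "Cauchy (\<lambda>n. proj_norm (X n))"
    unfolding Cauchy_def dist_real_def
  proof (intro allI impI)
    fix e :: real assume "0 < e"
    then obtain N where "\<forall>m\<ge>N. \<forall>n\<ge>N. proj_norm (X m - X n) < e"
      using assms unfolding proj_Cauchy_def by blast
    then show "\<exists>N. \<forall>m\<ge>N. \<forall>n\<ge>N. \<bar>proj_norm (X m) - proj_norm (X n)\<bar> < e"
      by (meson proj_norm_abs_diff le_less_trans)
  qed
qed

lemma proj_Cauchy_lim:
  "proj_Cauchy X \<Longrightarrow> (\<lambda>n. proj_norm (X n)) \<longlonglongrightarrow> lim (\<lambda>n. proj_norm (X n))"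
  using proj_Cauchy_convergent by (rule convergent_LIMSEQ_iff[THEN iffD1])

lemma proj_norm_null_add:
  assumes "(\<lambda>n. proj_norm (X n)) \<longlonglongrightarrow> 0" "(\<lambda>n. proj_norm (Y n)) \<longlonglongrightarrow> 0"
  shows "(\<lambda>n. proj_norm (X n + Y n)) \<longlonglongrightarrow> 0"
  by (rule Lim_null_comparison[where g = "\<lambda>n. proj_norm (X n) + proj_norm (Y n)"])
    (use tendsto_add[OF assms] in \<open>auto simp: proj_norm_ge0 proj_norm_triangle\<close>)

lemma part_equivp_ptensor_rel: "part_equivp (ptensor_rel :: (nat \<Rightarrow> ('a :: complex_banach, 'b :: complex_banach) atensor) \<Rightarrow> _)"
proof (rule part_equivpI)
  show "\<exists>X :: nat \<Rightarrow> ('a, 'b) atensor. ptensor_rel X X"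
    by (rule exI[of _ "\<lambda>_. 0"]) (simp add: ptensor_rel_def)
  show "symp (ptensor_rel :: (nat \<Rightarrow> ('a, 'b) atensor) \<Rightarrow> _)"
  proof (rule sympI)
    fix X Y :: "nat \<Rightarrow> ('a, 'b) atensor"
    assume "ptensor_rel X Y"
    then show "ptensor_rel Y X"
      by (simp add: ptensor_rel_def proj_norm_minus_commute[of "Y _"])
  qed
  show "transp (ptensor_rel :: (nat \<Rightarrow> ('a, 'b) atensor) \<Rightarrow> _)"
  proof (rule transpI)
    fix X Y Z :: "nat \<Rightarrow> ('a, 'b) atensor"
    assume "ptensor_rel X Y" "ptensor_rel Y Z"
    then show "ptensor_rel X Z"
      using proj_norm_null_add[of "\<lambda>n. X n - Y n" "\<lambda>n. Y n - Z n"] by (simp add: ptensor_rel_def)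
  qed
qed

quotient_type (overloaded) ('a, 'b) ptensor =
  "nat \<Rightarrow> ('a :: complex_banach, 'b :: complex_banach) atensor" / partial: ptensor_rel
  by (rule part_equivp_ptensor_rel)

lemma ptensor_rel_refl [simp]: "ptensor_rel X X \<longleftrightarrow> proj_Cauchy X"
  by (simp add: ptensor_rel_def)

lemma ptensor_rel_scale:
  assumes "ptensor_rel X Y"
  shows "ptensor_rel (\<lambda>n. atensor_scale c (X n)) (\<lambda>n. atensor_scale c (Y n))"
  using assms tendsto_mult_left[of "\<lambda>n. proj_norm (X n - Y n)" 0 sequentially "cmod c"]
  by (simp add: ptensor_rel_def proj_Cauchy_scale atensor_scale_diff[symmetric] proj_norm_scale)

lemma ptensor_rel_add:
  assumes "ptensor_rel X Y" "ptensor_rel X' Y'"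
  shows "ptensor_rel (\<lambda>n. X n + X' n) (\<lambda>n. Y n + Y' n)"
proof -
  have "(\<lambda>n. proj_norm ((X n - Y n) + (X' n - Y' n))) \<longlonglongrightarrow> 0"
    using assms by (intro proj_norm_null_add) (auto simp: ptensor_rel_def)
  moreover have "(X n - Y n) + (X' n - Y' n) = (X n + X' n) - (Y n + Y' n)" for n
    by (simp add: algebra_simps)
  ultimately show ?thesis using assms by (simp add: ptensor_rel_def proj_Cauchy_add)
qed

lemma ptensor_rel_uminus: "ptensor_rel X Y \<Longrightarrow> ptensor_rel (\<lambda>n. - X n) (\<lambda>n. - Y n)"
  using ptensor_rel_scale[of X Y "-1"] by (simp add: atensor_scale_minus_one)

lemma ptensor_rel_diff:
  "ptensor_rel X Y \<Longrightarrow> ptensor_rel X' Y' \<Longrightarrow> ptensor_rel (\<lambda>n. X n - X' n) (\<lambda>n. Y n - Y' n)"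
  using ptensor_rel_add[of X Y "\<lambda>n. - X' n" "\<lambda>n. - Y' n"] by (simp add: ptensor_rel_uminus)

lemma lim_proj_norm_eq:
  assumes "ptensor_rel X Y"
  shows "lim (\<lambda>n. proj_norm (X n)) = lim (\<lambda>n. proj_norm (Y n))"
proof -
  have X: "(\<lambda>n. proj_norm (X n)) \<longlonglongrightarrow> lim (\<lambda>n. proj_norm (X n))"
    using assms by (intro proj_Cauchy_lim) (simp add: ptensor_rel_def)
  have "(\<lambda>n. proj_norm (Y n) - proj_norm (X n)) \<longlonglongrightarrow> 0"
    by (rule Lim_null_comparison[where g = "\<lambda>n. proj_norm (X n - Y n)"])
      (use assms in \<open>auto simp: ptensor_rel_def proj_norm_minus_commute[of "X _"] proj_norm_abs_diff\<close>)
  from tendsto_add[OF this X] have "(\<lambda>n. proj_norm (Y n)) \<longlonglongrightarrow> lim (\<lambda>n. proj_norm (X n))" by simp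
  then show ?thesis by (rule limI[symmetric])
qed

instantiation ptensor :: (complex_banach, complex_banach) real_normed_vector
begin
lift_definition zero_ptensor :: "('a, 'b) ptensor" is "\<lambda>_. 0" by simp
lift_definition plus_ptensor :: "('a, 'b) ptensor \<Rightarrow> ('a, 'b) ptensor \<Rightarrow> ('a, 'b) ptensor"
  is "\<lambda>X Y n. X n + Y n" by (rule ptensor_rel_add)
lift_definition minus_ptensor :: "('a, 'b) ptensor \<Rightarrow> ('a, 'b) ptensor \<Rightarrow> ('a, 'b) ptensor"
  is "\<lambda>X Y n. X n - Y n" by (rule ptensor_rel_diff)
lift_definition uminus_ptensor :: "('a, 'b) ptensor \<Rightarrow> ('a, 'b) ptensor"
  is "\<lambda>X n. - X n" by (rule ptensor_rel_uminus)
lift_definition scaleR_ptensor :: "real \<Rightarrow> ('a, 'b) ptensor \<Rightarrow> ('a, 'b) ptensor"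
  is "\<lambda>r X n. atensor_scale (complex_of_real r) (X n)" by (rule ptensor_rel_scale)
lift_definition norm_ptensor :: "('a, 'b) ptensor \<Rightarrow> real"
  is "\<lambda>X. lim (\<lambda>n. proj_norm (X n))" by (rule lim_proj_norm_eq)
definition "dist_ptensor (u :: ('a, 'b) ptensor) v = norm (u - v)"
definition "sgn_ptensor (u :: ('a, 'b) ptensor) = scaleR (inverse (norm u)) u"
definition "(uniformity :: (('a, 'b) ptensor \<times> ('a, 'b) ptensor) filter) =
  (INF e\<in>{0<..}. principal {(u, v). dist u v < e})"
definition "open (S :: ('a, 'b) ptensor set) \<longleftrightarrow>
  (\<forall>u\<in>S. \<forall>\<^sub>F (u', v) in uniformity. u' = u \<longrightarrow> v \<in> S)"
instance
proof
  fix u v w :: "('a, 'b) ptensor" and r s :: real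
  show "u + v + w = u + (v + w)"
    by transfer (simp add: add.assoc proj_Cauchy_add)
  show "u + v = v + u"
    by transfer (simp add: add.commute proj_Cauchy_add)
  show "0 + u = u" by transfer simp
  show "- u + u = 0" by transfer simp
  show "u - v = u + - v" by transfer (simp add: proj_Cauchy_diff)
  show "r *\<^sub>R (u + v) = r *\<^sub>R u + r *\<^sub>R v"
    by transfer (simp add: atensor_scale_add proj_Cauchy_add proj_Cauchy_scale)
  show "(r + s) *\<^sub>R u = r *\<^sub>R u + s *\<^sub>R u"
    by transfer (simp add: atensor_scale_add_left proj_Cauchy_add proj_Cauchy_scale)
  show "r *\<^sub>R s *\<^sub>R u = (r * s) *\<^sub>R u"
    by transfer (simp add: atensor_scale_scale proj_Cauchy_scale)
  show "1 *\<^sub>R u = u" by transfer (simp add: atensor_scale_one)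
  show "dist u v = norm (u - v)" by (simp add: dist_ptensor_def)
  show "sgn u = inverse (norm u) *\<^sub>R u" by (simp add: sgn_ptensor_def)
  show "norm u = 0 \<longleftrightarrow> u = 0"
  proof transfer
    fix X :: "nat \<Rightarrow> ('a, 'b) atensor"
    assume "ptensor_rel X X"
    then have X: "proj_Cauchy X" by simp
    show "lim (\<lambda>n. proj_norm (X n)) = 0 \<longleftrightarrow> ptensor_rel X (\<lambda>_. 0)"
    proof
      assume "lim (\<lambda>n. proj_norm (X n)) = 0"
      then show "ptensor_rel X (\<lambda>_. 0)"
        using proj_Cauchy_lim[OF X] X by (simp add: ptensor_rel_def)
    next
      assume "ptensor_rel X (\<lambda>_. 0)"
      then have "(\<lambda>n. proj_norm (X n)) \<longlonglongrightarrow> 0" by (simp add: ptensor_rel_def)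
      then show "lim (\<lambda>n. proj_norm (X n)) = 0" by (rule limI)
    qed
  qed
  show "norm (u + v) \<le> norm u + norm v"
  proof transfer
    fix X Y :: "nat \<Rightarrow> ('a, 'b) atensor"
    assume "ptensor_rel X X" "ptensor_rel Y Y"
    then have X: "proj_Cauchy X" and Y: "proj_Cauchy Y" by simp_all
    show "lim (\<lambda>n. proj_norm (X n + Y n)) \<le> lim (\<lambda>n. proj_norm (X n)) + lim (\<lambda>n. proj_norm (Y n))"
    proof (rule LIMSEQ_le)
      show "(\<lambda>n. proj_norm (X n + Y n)) \<longlonglongrightarrow> lim (\<lambda>n. proj_norm (X n + Y n))"
        by (rule proj_Cauchy_lim[OF proj_Cauchy_add[OF X Y]])
      show "(\<lambda>n. proj_norm (X n) + proj_norm (Y n)) \<longlonglongrightarrow> lim (\<lambda>n. proj_norm (X n)) + lim (\<lambda>n. proj_norm (Y n))"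
        by (intro tendsto_add proj_Cauchy_lim X Y)
    qed (use proj_norm_triangle in blast)
  qed
  show "norm (r *\<^sub>R u) = \<bar>r\<bar> * norm u"
  proof (transfer fixing: r)
    fix X :: "nat \<Rightarrow> ('a, 'b) atensor"
    assume "ptensor_rel X X"
    then have "(\<lambda>n. proj_norm (X n)) \<longlonglongrightarrow> lim (\<lambda>n. proj_norm (X n))"
      using proj_Cauchy_lim[of X] by simp
    then have "(\<lambda>n. \<bar>r\<bar> * proj_norm (X n)) \<longlonglongrightarrow> \<bar>r\<bar> * lim (\<lambda>n. proj_norm (X n))"
      by (rule tendsto_mult_left)
    then show "lim (\<lambda>n. proj_norm (atensor_scale (complex_of_real r) (X n))) = \<bar>r\<bar> * lim (\<lambda>n. proj_norm (X n))"
      unfolding proj_norm_scale norm_of_real by (rule limI)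
  qed
qed (rule uniformity_ptensor_def open_ptensor_def)+
end

text \<open>The canonical map of the algebraic tensor product into its completion.\<close>

lift_definition ptensor_of :: "('a :: complex_banach, 'b :: complex_banach) atensor \<Rightarrow> ('a, 'b) ptensor"
  is "\<lambda>t _. t" by simp

lemma ptensor_of_diff: "ptensor_of (s - t) = ptensor_of s - ptensor_of t"
  by transfer simp

lemma ptensor_of_add: "ptensor_of (s + t) = ptensor_of s + ptensor_of t"
  by transfer simp

lemma norm_ptensor_of: "norm (ptensor_of t) = proj_norm t"
  by transfer simp

lemma ptensor_rep:
  obtains X where "proj_Cauchy X" "u = abs_ptensor X"
proof -
  have "ptensor_rel (rep_ptensor u) (rep_ptensor u)"
    by (rule Quotient_rep_reflp[OF Quotient_ptensor])
  moreover have "u = abs_ptensor (rep_ptensor u)"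
    by (rule Quotient_abs_rep[OF Quotient_ptensor, symmetric])
  ultimately show ?thesis using that by simp
qed

lemma norm_abs_ptensor:
  assumes "proj_Cauchy X"
  shows "(\<lambda>n. proj_norm (X n)) \<longlonglongrightarrow> norm (abs_ptensor X)"
  using proj_Cauchy_lim[OF assms] assms by (simp add: norm_ptensor.abs_eq)

lemma abs_ptensor_diff: "proj_Cauchy X \<Longrightarrow> proj_Cauchy Y \<Longrightarrow> abs_ptensor X - abs_ptensor Y = abs_ptensor (\<lambda>n. X n - Y n)"
  by (simp add: minus_ptensor.abs_eq)

lemma ptensor_of_tendsto:
  assumes X: "proj_Cauchy X"
  shows "(\<lambda>n. ptensor_of (X n)) \<longlonglongrightarrow> abs_ptensor X"
  unfolding LIMSEQ_iff
proof (intro allI impI)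
  fix e :: real assume "0 < e"
  then have e: "0 < e / 2" by simp
  obtain N where N: "\<And>m n. m \<ge> N \<Longrightarrow> n \<ge> N \<Longrightarrow> proj_norm (X m - X n) < e / 2"
    using X e unfolding proj_Cauchy_def by blast
  have "norm (ptensor_of (X n) - abs_ptensor X) < e" if n: "n \<ge> N" for n
  proof -
    have "ptensor_of (X n) - abs_ptensor X = abs_ptensor (\<lambda>m. X n - X m)"
      using X by (simp add: ptensor_of.abs_eq abs_ptensor_diff)
    moreover have "(\<lambda>m. proj_norm (X n - X m)) \<longlonglongrightarrow> norm (abs_ptensor (\<lambda>m. X n - X m))"
      by (intro norm_abs_ptensor proj_Cauchy_diff X proj_Cauchy_const)
    then have "norm (abs_ptensor (\<lambda>m. X n - X m)) \<le> e / 2"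
      by (rule LIMSEQ_le_const2) (use N[OF n] in \<open>auto intro!: exI[of _ N] less_imp_le\<close>)
    ultimately show ?thesis using \<open>0 < e\<close> by simp
  qed
  then show "\<exists>N. \<forall>n\<ge>N. norm (ptensor_of (X n) - abs_ptensor X) < e" by blast
qed

lemma ptensor_approx:
  assumes "e > 0"
  obtains t where "norm (u - ptensor_of t) < e"
proof -
  obtain X where X: "proj_Cauchy X" "u = abs_ptensor X" by (rule ptensor_rep)
  from ptensor_of_tendsto[OF X(1)] assms obtain n where "norm (ptensor_of (X n) - u) < e"
    unfolding LIMSEQ_iff X(2) by blast
  then show ?thesis using that by (simp add: norm_minus_commute)
qed

instantiation ptensor :: (complex_banach, complex_banach) complex_banach
begin
lift_definition scaleC_ptensor :: "complex \<Rightarrow> ('a, 'b) ptensor \<Rightarrow> ('a, 'b) ptensor"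
  is "\<lambda>c X n. atensor_scale c (X n)" by (rule ptensor_rel_scale)
instance
proof
  fix U :: "nat \<Rightarrow> ('a, 'b) ptensor"
  assume U: "Cauchy U"
  have "\<exists>t. norm (U n - ptensor_of t) < 1 / Suc n" for n
    by (rule ptensor_approx[of "1 / Suc n" "U n"]) auto
  then obtain t where t: "\<And>n. norm (U n - ptensor_of (t n)) < 1 / Suc n" by metis
  have lim: "(\<lambda>n. U n - ptensor_of (t n)) \<longlonglongrightarrow> 0"
    by (rule Lim_null_comparison[OF _ LIMSEQ_inverse_real_of_nat])
      (use t in \<open>auto simp: inverse_eq_divide intro!: always_eventually less_imp_le\<close>)
  have "proj_Cauchy t"
    unfolding proj_Cauchy_def
  proof (intro allI impI)
    fix e :: real assume "0 < e"
    then have e: "0 < e / 2" by simp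
    obtain M where M: "\<And>m n. m \<ge> M \<Longrightarrow> n \<ge> M \<Longrightarrow> norm (U m - U n) < e / 2"
      using CauchyD[OF U e] by blast
    obtain N where N: "\<And>m n. m \<ge> N \<Longrightarrow> n \<ge> N \<Longrightarrow>
        norm ((U m - ptensor_of (t m)) - (U n - ptensor_of (t n))) < e / 2"
      using CauchyD[OF LIMSEQ_imp_Cauchy[OF lim] e] by blast
    have "proj_norm (t m - t n) < e" if "m \<ge> max M N" "n \<ge> max M N" for m n
    proof -
      have "ptensor_of (t m - t n) =
          (U m - U n) - ((U m - ptensor_of (t m)) - (U n - ptensor_of (t n)))"
        by (simp add: ptensor_of_diff)
      then show ?thesis
        using norm_triangle_ineq4[of "U m - U n" "(U m - ptensor_of (t m)) - (U n - ptensor_of (t n))"]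
          M[of m n] N[of m n] that
        by (simp add: norm_ptensor_of[symmetric])
    qed
    then show "\<exists>N. \<forall>m\<ge>N. \<forall>n\<ge>N. proj_norm (t m - t n) < e" by blast
  qed
  then have "(\<lambda>n. (U n - ptensor_of (t n)) + ptensor_of (t n)) \<longlonglongrightarrow> 0 + abs_ptensor t"
    by (intro tendsto_add lim ptensor_of_tendsto)
  then show "convergent U" by (auto simp: convergent_def)
next
  fix u v :: "('a, 'b) ptensor" and c d :: complex and r :: real
  show "c *\<^sub>C (u + v) = c *\<^sub>C u + c *\<^sub>C v"
    by transfer (simp add: atensor_scale_add proj_Cauchy_add proj_Cauchy_scale)
  show "(c + d) *\<^sub>C u = c *\<^sub>C u + d *\<^sub>C u"
    by transfer (simp add: atensor_scale_add_left proj_Cauchy_add proj_Cauchy_scale)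
  show "c *\<^sub>C d *\<^sub>C u = (c * d) *\<^sub>C u"
    by transfer (simp add: atensor_scale_scale proj_Cauchy_scale)
  show "complex_of_real r *\<^sub>C u = r *\<^sub>R u"
    by transfer (simp add: proj_Cauchy_scale)
  show "norm (c *\<^sub>C u) = cmod c * norm u"
  proof (transfer fixing: c)
    fix X :: "nat \<Rightarrow> ('a, 'b) atensor"
    assume "ptensor_rel X X"
    then have "(\<lambda>n. proj_norm (X n)) \<longlonglongrightarrow> lim (\<lambda>n. proj_norm (X n))"
      using proj_Cauchy_lim[of X] by simp
    then have "(\<lambda>n. cmod c * proj_norm (X n)) \<longlonglongrightarrow> cmod c * lim (\<lambda>n. proj_norm (X n))"
      by (rule tendsto_mult_left)
    then show "lim (\<lambda>n. proj_norm (atensor_scale c (X n))) = cmod c * lim (\<lambda>n. proj_norm (X n))"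
      unfolding proj_norm_scale by (rule limI)
  qed
qed
end

lemma ptensor_of_scale: "ptensor_of (atensor_scale c t) = c *\<^sub>C ptensor_of t"
  by transfer simp

definition ptens :: "'a :: complex_banach \<Rightarrow> 'b :: complex_banach \<Rightarrow> ('a, 'b) ptensor" (infixl "\<otimes>\<^sub>\<pi>" 70) where
  "a \<otimes>\<^sub>\<pi> b = ptensor_of (atens a b)"

lemma bounded_cbilinear_ptens: "bounded_cbilinear (\<otimes>\<^sub>\<pi>)"
  unfolding bounded_cbilinear_def
proof (intro conjI allI)
  have s: "r *\<^sub>R x = complex_of_real r *\<^sub>C x" for r and x :: "'d :: complex_banach"
    by (simp add: scaleC_of_real)
  show "bounded_bilinear ((\<otimes>\<^sub>\<pi>) :: 'a \<Rightarrow> 'b \<Rightarrow> ('a, 'b) ptensor)"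
  proof
    show "\<exists>K. \<forall>(a :: 'a) (b :: 'b). norm (a \<otimes>\<^sub>\<pi> b) \<le> norm a * norm b * K"
      by (rule exI[of _ 1]) (simp add: ptens_def norm_ptensor_of proj_norm_atens)
  qed (simp_all add: s ptens_def atens_add_left atens_add_right ptensor_of_add atens_scale_left
      atens_scale_right ptensor_of_scale)
qed (simp_all add: ptens_def atens_scale_left atens_scale_right ptensor_of_scale)

lemma bounded_clinear_eq_on_ptens:
  fixes S T :: "('a :: complex_banach, 'b :: complex_banach) ptensor \<Rightarrow> 'c :: complex_banach"
  assumes S: "bounded_clinear S" and T: "bounded_clinear T" and eq: "\<And>a b. S (a \<otimes>\<^sub>\<pi> b) = T (a \<otimes>\<^sub>\<pi> b)"
  shows "S = T"
proof
  fix u :: "('a, 'b) ptensor"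
  interpret S: bounded_linear S using S by (simp add: bounded_clinear_def)
  interpret T: bounded_linear T using T by (simp add: bounded_clinear_def)
  have "S (ptensor_of t) = T (ptensor_of t)" for t :: "('a, 'b) atensor"
  proof -
    obtain xs where t: "t = atensor_sum xs" by (rule atensor_sum_exhaust)
    have z: "ptensor_of 0 = (0 :: ('a, 'b) ptensor)" by transfer simp
    show ?thesis unfolding t
      by (induction xs) (auto simp: z S.zero T.zero ptensor_of_add S.add T.add eq[unfolded ptens_def])
  qed
  moreover obtain X where X: "proj_Cauchy X" "u = abs_ptensor X" by (rule ptensor_rep)
  ultimately have "(\<lambda>n. T (ptensor_of (X n))) \<longlonglongrightarrow> S u"
    using S.tendsto[OF ptensor_of_tendsto[OF X(1)]] X(2) by simp
  moreover have "(\<lambda>n. T (ptensor_of (X n))) \<longlonglongrightarrow> T u"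
    using T.tendsto[OF ptensor_of_tendsto[OF X(1)]] X(2) by simp
  ultimately show "S u = T u" by (rule LIMSEQ_unique)
qed

text \<open>By \<open>bounded_clinear_ptensor_lift\<close> and \<open>ptensor_lift_ptens\<close> below, the definite description
  is well-defined for every bounded bilinear map.\<close>

definition ptensor_lift ::
    "('a :: complex_banach \<Rightarrow> 'b :: complex_banach \<Rightarrow> 'c :: complex_banach) \<Rightarrow> ('a, 'b) ptensor \<Rightarrow> 'c" where
  "ptensor_lift f = (THE T. bounded_clinear T \<and> (\<forall>a b. T (a \<otimes>\<^sub>\<pi> b) = f a b))"

lemma ptensor_lift_exists:
  fixes f :: "'a :: complex_banach \<Rightarrow> 'b :: complex_banach \<Rightarrow> 'c :: complex_banach"
  assumes f: "bounded_cbilinear f"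
    and K: "\<And>a b. norm (f a b) \<le> norm a * norm b * K" "K \<ge> 0"
  obtains T where "bounded_clinear T" "\<And>a b. T (a \<otimes>\<^sub>\<pi> b) = f a b" "\<And>u. norm (T u) \<le> norm u * K"
proof -
  define T where "T u = lim (\<lambda>n. alift f (rep_ptensor u n))" for u
  have conv: "convergent (\<lambda>n. alift f (X n))" if X: "proj_Cauchy X" for X
  proof (rule Cauchy_convergent, unfold Cauchy_def dist_norm, intro allI impI)
    fix e :: real assume "0 < e"
    then have "0 < e / (K + 1)" using K(2) by simp
    then obtain N where N: "\<And>m n. m \<ge> N \<Longrightarrow> n \<ge> N \<Longrightarrow> proj_norm (X m - X n) < e / (K + 1)"
      using X unfolding proj_Cauchy_def by blast
    have "norm (alift f (X m) - alift f (X n)) < e" if "m \<ge> N" "n \<ge> N" for m n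
    proof -
      have "norm (alift f (X m) - alift f (X n)) \<le> proj_norm (X m - X n) * K"
        using alift_bound[OF f K] by (simp add: alift_diff[OF f, symmetric])
      also have "\<dots> \<le> proj_norm (X m - X n) * (K + 1)"
        by (intro mult_left_mono proj_norm_ge0) simp
      also have "\<dots> < e" using N[OF that] K(2) by (simp add: pos_less_divide_eq)
      finally show ?thesis .
    qed
    then show "\<exists>N. \<forall>m\<ge>N. \<forall>n\<ge>N. norm (alift f (X m) - alift f (X n)) < e" by blast
  qed
  have T: "(\<lambda>n. alift f (X n)) \<longlonglongrightarrow> T (abs_ptensor X)" if X: "proj_Cauchy X" for X
  proof -
    let ?Y = "rep_ptensor (abs_ptensor X)"
    have rel: "ptensor_rel ?Y X"
      using Quotient_rep_abs[OF Quotient_ptensor, of X] X by simp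
    then have Y: "proj_Cauchy ?Y" by (simp add: ptensor_rel_def)
    have "(\<lambda>n. alift f (X n) - alift f (?Y n)) \<longlonglongrightarrow> 0"
    proof (rule Lim_null_comparison)
      show "\<forall>\<^sub>F n in sequentially. norm (alift f (X n) - alift f (?Y n)) \<le> proj_norm (?Y n - X n) * K"
        using alift_bound[OF f K] by (simp add: alift_diff[OF f, symmetric] proj_norm_minus_commute[of "?Y _"])
      show "(\<lambda>n. proj_norm (?Y n - X n) * K) \<longlonglongrightarrow> 0"
        using rel tendsto_mult_left_zero by (auto simp: ptensor_rel_def)
    qed
    moreover have "(\<lambda>n. alift f (?Y n)) \<longlonglongrightarrow> T (abs_ptensor X)"
      using conv[OF Y] unfolding T_def by (rule convergent_LIMSEQ_iff[THEN iffD1])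
    ultimately have "(\<lambda>n. (alift f (X n) - alift f (?Y n)) + alift f (?Y n)) \<longlonglongrightarrow> 0 + T (abs_ptensor X)"
      by (rule tendsto_add)
    then show ?thesis by simp
  qed
  have add: "T (u + v) = T u + T v" for u v
  proof -
    obtain X where X: "proj_Cauchy X" "u = abs_ptensor X" by (rule ptensor_rep)
    obtain Y where Y: "proj_Cauchy Y" "v = abs_ptensor Y" by (rule ptensor_rep)
    have "u + v = abs_ptensor (\<lambda>n. X n + Y n)"
      using X Y by (simp add: plus_ptensor.abs_eq)
    then show ?thesis
      using LIMSEQ_unique[OF T[OF proj_Cauchy_add[OF X(1) Y(1)], unfolded alift_add[OF f]]
          tendsto_add[OF T[OF X(1)] T[OF Y(1)]]] X(2) Y(2)
      by simp
  qed
  have scale: "T (c *\<^sub>C u) = c *\<^sub>C T u" for c u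
  proof -
    obtain X where X: "proj_Cauchy X" "u = abs_ptensor X" by (rule ptensor_rep)
    have "c *\<^sub>C u = abs_ptensor (\<lambda>n. atensor_scale c (X n))"
      using X by (simp add: scaleC_ptensor.abs_eq)
    then show ?thesis
      using LIMSEQ_unique[OF T[OF proj_Cauchy_scale[OF X(1), of c], unfolded alift_scale[OF f]]
          bounded_linear.tendsto[OF bounded_linear_scaleC T[OF X(1)], of c]] X(2)
      by simp
  qed
  have bound: "norm (T u) \<le> norm u * K" for u
  proof -
    obtain X where X: "proj_Cauchy X" "u = abs_ptensor X" by (rule ptensor_rep)
    show ?thesis unfolding X(2)
      by (rule LIMSEQ_le[OF tendsto_norm[OF T[OF X(1)]] tendsto_mult_right[OF norm_abs_ptensor[OF X(1)]]])
        (use alift_bound[OF f K] in blast)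
  qed
  have "bounded_linear T"
  proof (rule bounded_linear_intro[where K = K])
    show "T (r *\<^sub>R u) = r *\<^sub>R T u" for r u using scale[of "complex_of_real r" u] by (simp add: scaleC_of_real)
  qed (rule add bound)+
  then have "bounded_clinear T" by (simp add: bounded_clinear_def scale)
  moreover have "T (a \<otimes>\<^sub>\<pi> b) = f a b" for a b
    using T[of "\<lambda>_. atens a b"] by (simp add: ptens_def ptensor_of.abs_eq alift_atens[OF f] LIMSEQ_const_iff)
  ultimately show ?thesis using that bound by blast
qed

lemma
  assumes f: "bounded_cbilinear f"
  shows bounded_clinear_ptensor_lift: "bounded_clinear (ptensor_lift f)"
    and ptensor_lift_ptens: "ptensor_lift f (a \<otimes>\<^sub>\<pi> b) = f a b"
proof -
  interpret bounded_bilinear f using f by (simp add: bounded_cbilinear_def)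
  obtain K where K: "K \<ge> 0" "\<And>a b. norm (f a b) \<le> norm a * norm b * K"
    using nonneg_bounded by blast
  obtain T where T: "bounded_clinear T" "\<And>a b. T (a \<otimes>\<^sub>\<pi> b) = f a b"
    using ptensor_lift_exists[OF f K(2,1)] by metis
  have "ptensor_lift f = T"
    unfolding ptensor_lift_def
    by (rule the_equality) (use T in \<open>auto intro: bounded_clinear_eq_on_ptens\<close>)
  then show "bounded_clinear (ptensor_lift f)" "ptensor_lift f (a \<otimes>\<^sub>\<pi> b) = f a b"
    using T by auto
qed

section \<open>Contractible Banach algebras\<close>

text \<open>A contractible algebra is tested on all Banach bimodules, so the underlying space of a
  bimodule is an arbitrary set with explicitly given operations rather than a type. Values of the
  operations outside \<open>bm_carrier\<close> are irrelevant.\<close>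

record ('a, 'e) bimodule =
  bm_carrier :: "'e set"
  bm_zero :: 'e
  bm_add :: "'e \<Rightarrow> 'e \<Rightarrow> 'e"
  bm_scale :: "complex \<Rightarrow> 'e \<Rightarrow> 'e"
  bm_norm :: "'e \<Rightarrow> real"
  bm_left :: "'a \<Rightarrow> 'e \<Rightarrow> 'e"
  bm_right :: "'e \<Rightarrow> 'a \<Rightarrow> 'e"

definition bm_diff :: "('a, 'e) bimodule \<Rightarrow> 'e \<Rightarrow> 'e \<Rightarrow> 'e" where
  "bm_diff E x y = bm_add E x (bm_scale E (-1) y)"

locale banach_bimodule =
  fixes E :: "('a :: complex_banach_algebra, 'e) bimodule"
  assumes zero_closed: "bm_zero E \<in> bm_carrier E"
    and add_closed: "\<lbrakk>x \<in> bm_carrier E; y \<in> bm_carrier E\<rbrakk> \<Longrightarrow> bm_add E x y \<in> bm_carrier E"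
    and scale_closed: "x \<in> bm_carrier E \<Longrightarrow> bm_scale E c x \<in> bm_carrier E"
    and left_closed: "x \<in> bm_carrier E \<Longrightarrow> bm_left E a x \<in> bm_carrier E"
    and right_closed: "x \<in> bm_carrier E \<Longrightarrow> bm_right E x a \<in> bm_carrier E"
    and add_assoc: "\<lbrakk>x \<in> bm_carrier E; y \<in> bm_carrier E; z \<in> bm_carrier E\<rbrakk> \<Longrightarrow>
      bm_add E (bm_add E x y) z = bm_add E x (bm_add E y z)"
    and add_commute: "\<lbrakk>x \<in> bm_carrier E; y \<in> bm_carrier E\<rbrakk> \<Longrightarrow> bm_add E x y = bm_add E y x"
    and add_zero: "x \<in> bm_carrier E \<Longrightarrow> bm_add E (bm_zero E) x = x"
    and diff_self: "x \<in> bm_carrier E \<Longrightarrow> bm_diff E x x = bm_zero E"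
    and scale_add_right: "\<lbrakk>x \<in> bm_carrier E; y \<in> bm_carrier E\<rbrakk> \<Longrightarrow>
      bm_scale E c (bm_add E x y) = bm_add E (bm_scale E c x) (bm_scale E c y)"
    and scale_add_left: "x \<in> bm_carrier E \<Longrightarrow>
      bm_scale E (c + d) x = bm_add E (bm_scale E c x) (bm_scale E d x)"
    and scale_scale: "x \<in> bm_carrier E \<Longrightarrow> bm_scale E c (bm_scale E d x) = bm_scale E (c * d) x"
    and scale_one: "x \<in> bm_carrier E \<Longrightarrow> bm_scale E 1 x = x"
    and norm_eq_zero: "x \<in> bm_carrier E \<Longrightarrow> bm_norm E x = 0 \<longleftrightarrow> x = bm_zero E"
    and norm_triangle: "\<lbrakk>x \<in> bm_carrier E; y \<in> bm_carrier E\<rbrakk> \<Longrightarrow>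
      bm_norm E (bm_add E x y) \<le> bm_norm E x + bm_norm E y"
    and norm_scale: "x \<in> bm_carrier E \<Longrightarrow> bm_norm E (bm_scale E c x) = cmod c * bm_norm E x"
    and complete: "\<lbrakk>\<forall>n. X n \<in> bm_carrier E;
      \<forall>e>0. \<exists>N. \<forall>m\<ge>N. \<forall>n\<ge>N. bm_norm E (bm_diff E (X m) (X n)) < e\<rbrakk> \<Longrightarrow>
      \<exists>x\<in>bm_carrier E. (\<lambda>n. bm_norm E (bm_diff E (X n) x)) \<longlonglongrightarrow> 0"
    and left_add_right: "\<lbrakk>x \<in> bm_carrier E; y \<in> bm_carrier E\<rbrakk> \<Longrightarrow>
      bm_left E a (bm_add E x y) = bm_add E (bm_left E a x) (bm_left E a y)"
    and left_add_left: "x \<in> bm_carrier E \<Longrightarrow>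
      bm_left E (a + b) x = bm_add E (bm_left E a x) (bm_left E b x)"
    and left_scale_right: "x \<in> bm_carrier E \<Longrightarrow>
      bm_left E a (bm_scale E c x) = bm_scale E c (bm_left E a x)"
    and left_scale_left: "x \<in> bm_carrier E \<Longrightarrow>
      bm_left E (c *\<^sub>C a) x = bm_scale E c (bm_left E a x)"
    and left_bounded: "\<exists>K. \<forall>a. \<forall>x\<in>bm_carrier E. bm_norm E (bm_left E a x) \<le> K * norm a * bm_norm E x"
    and right_add_left: "\<lbrakk>x \<in> bm_carrier E; y \<in> bm_carrier E\<rbrakk> \<Longrightarrow>
      bm_right E (bm_add E x y) a = bm_add E (bm_right E x a) (bm_right E y a)"
    and right_add_right: "x \<in> bm_carrier E \<Longrightarrow>
      bm_right E x (a + b) = bm_add E (bm_right E x a) (bm_right E x b)"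
    and right_scale_left: "x \<in> bm_carrier E \<Longrightarrow>
      bm_right E (bm_scale E c x) a = bm_scale E c (bm_right E x a)"
    and right_scale_right: "x \<in> bm_carrier E \<Longrightarrow>
      bm_right E x (c *\<^sub>C a) = bm_scale E c (bm_right E x a)"
    and right_bounded: "\<exists>K. \<forall>a. \<forall>x\<in>bm_carrier E. bm_norm E (bm_right E x a) \<le> K * norm a * bm_norm E x"
    and left_left: "x \<in> bm_carrier E \<Longrightarrow> bm_left E a (bm_left E b x) = bm_left E (a * b) x"
    and right_right: "x \<in> bm_carrier E \<Longrightarrow> bm_right E (bm_right E x a) b = bm_right E x (a * b)"
    and left_right: "x \<in> bm_carrier E \<Longrightarrow> bm_right E (bm_left E a x) b = bm_left E a (bm_right E x b)"

definition derivation :: "('a :: complex_banach_algebra, 'e) bimodule \<Rightarrow> ('a \<Rightarrow> 'e) \<Rightarrow> bool" where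
  "derivation E D \<longleftrightarrow>
     (\<forall>a. D a \<in> bm_carrier E) \<and>
     (\<forall>a b. D (a + b) = bm_add E (D a) (D b)) \<and>
     (\<forall>c a. D (c *\<^sub>C a) = bm_scale E c (D a)) \<and>
     (\<exists>K. \<forall>a. bm_norm E (D a) \<le> K * norm a) \<and>
     (\<forall>a b. D (a * b) = bm_add E (bm_right E (D a) b) (bm_left E a (D b)))"

definition inner_derivation :: "('a :: complex_banach_algebra, 'e) bimodule \<Rightarrow> ('a \<Rightarrow> 'e) \<Rightarrow> bool" where
  "inner_derivation E D \<longleftrightarrow>
     (\<exists>z\<in>bm_carrier E. \<forall>a. D a = bm_diff E (bm_right E z a) (bm_left E a z))"

text \<open>HOL does not allow quantification over all types in a definition, so the bimodules range over
  all carrier sets in one sufficiently large type. This is no restriction: every element of the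
  closed sub-bimodule generated by the range of a derivation \<open>D\<close> is the limit of a sequence with
  terms of the form \<open>D a + b\<^sub>1 D c\<^sub>1 + \<dots> + b\<^sub>k D c\<^sub>k\<close>, so that this sub-bimodule embeds in the type
  below. Theorem \<open>contractible_algebraD\<close> proves the resulting independence: derivations into
  Banach bimodules over arbitrary types are inner.\<close>

definition contractible_algebra :: "'a :: complex_banach_algebra itself \<Rightarrow> bool" where
  "contractible_algebra _ \<longleftrightarrow>
     (\<forall>(E :: ('a, nat \<Rightarrow> 'a \<times> ('a \<times> 'a) list) bimodule) D.
        banach_bimodule E \<and> derivation E D \<longrightarrow> inner_derivation E D)"

context banach_bimodule
begin

abbreviation (input) M where "M \<equiv> bm_carrier E"
abbreviation (input) Add (infixl "\<oplus>" 65) where "x \<oplus> y \<equiv> bm_add E x y"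
abbreviation (input) Scale (infixr "\<odot>" 75) where "c \<odot> x \<equiv> bm_scale E c x"
abbreviation (input) Diff (infixl "\<ominus>" 65) where "x \<ominus> y \<equiv> bm_diff E x y"
abbreviation (input) Zer ("\<zero>") where "\<zero> \<equiv> bm_zero E"
abbreviation (input) N where "N x \<equiv> bm_norm E x"
abbreviation (input) L (infixr "\<rightharpoonup>" 75) where "a \<rightharpoonup> x \<equiv> bm_left E a x"
abbreviation (input) R (infixl "\<leftharpoonup>" 75) where "x \<leftharpoonup> a \<equiv> bm_right E x a"
abbreviation (input) d where "d x y \<equiv> N (x \<ominus> y)"

lemma diff_closed: "x \<in> M \<Longrightarrow> y \<in> M \<Longrightarrow> x \<ominus> y \<in> M"
  by (simp add: bm_diff_def add_closed scale_closed)

lemmas closed = zero_closed add_closed scale_closed diff_closed left_closed right_closed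

lemma add_left_commute: "x \<in> M \<Longrightarrow> y \<in> M \<Longrightarrow> z \<in> M \<Longrightarrow> x \<oplus> (y \<oplus> z) = y \<oplus> (x \<oplus> z)"
  by (metis add_assoc add_commute)

lemma zero_right: "x \<in> M \<Longrightarrow> x \<oplus> \<zero> = x"
  using add_commute[of x \<zero>] by (simp add: add_zero zero_closed)

lemma scale_zero_left: "x \<in> M \<Longrightarrow> 0 \<odot> x = \<zero>"
  using scale_add_left[of x 1 "-1"] diff_self[of x] by (simp add: scale_one bm_diff_def)

lemma scale_zero_right: "c \<odot> \<zero> = \<zero>"
  using scale_zero_left[of \<zero>] scale_scale[of \<zero> c 0] by (simp add: zero_closed)

lemma left_zero: "a \<rightharpoonup> \<zero> = \<zero>"
  using left_scale_right[of \<zero> a 0] by (simp add: scale_zero_left closed)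

lemma right_zero: "\<zero> \<leftharpoonup> a = \<zero>"
  using right_scale_left[of \<zero> 0 a] by (simp add: scale_zero_left closed)

lemma add_diff_interchange:
  assumes "x \<in> M" "y \<in> M" "x' \<in> M" "y' \<in> M"
  shows "(x \<oplus> y) \<ominus> (x' \<oplus> y') = (x \<ominus> x') \<oplus> (y \<ominus> y')"
  using assms
  by (simp add: bm_diff_def scale_add_right add_assoc add_left_commute closed)

lemma diff_add_diff: "x \<in> M \<Longrightarrow> y \<in> M \<Longrightarrow> z \<in> M \<Longrightarrow> (x \<ominus> y) \<oplus> (y \<ominus> z) = x \<ominus> z"
  using diff_self[of y] add_left_commute[of "(-1) \<odot> y" y "(-1) \<odot> z"]
    add_assoc[of y "(-1) \<odot> y" "(-1) \<odot> z"]
  by (simp add: bm_diff_def add_assoc add_zero closed)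

lemma scale_diff: "x \<in> M \<Longrightarrow> y \<in> M \<Longrightarrow> c \<odot> (x \<ominus> y) = (c \<odot> x) \<ominus> (c \<odot> y)"
  by (simp add: bm_diff_def scale_add_right scale_scale closed)

lemma left_diff: "x \<in> M \<Longrightarrow> y \<in> M \<Longrightarrow> a \<rightharpoonup> (x \<ominus> y) = (a \<rightharpoonup> x) \<ominus> (a \<rightharpoonup> y)"
  by (simp add: bm_diff_def left_add_right left_scale_right closed)

lemma right_diff: "x \<in> M \<Longrightarrow> y \<in> M \<Longrightarrow> (x \<ominus> y) \<leftharpoonup> a = (x \<leftharpoonup> a) \<ominus> (y \<leftharpoonup> a)"
  by (simp add: bm_diff_def right_add_left right_scale_left closed)

lemma norm_ge0: "x \<in> M \<Longrightarrow> 0 \<le> N x"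
  using norm_triangle[of x "(-1) \<odot> x"] diff_self[of x] norm_eq_zero[of \<zero>]
  by (simp add: norm_scale bm_diff_def closed)

lemma diff_eq_zero: "x \<in> M \<Longrightarrow> y \<in> M \<Longrightarrow> x \<ominus> y = \<zero> \<Longrightarrow> x = y"
  using add_assoc[of x "(-1) \<odot> y" y] add_commute[of "(-1) \<odot> y" y] diff_self[of y]
  by (simp add: bm_diff_def zero_right add_zero closed)

lemma d_commute: assumes "x \<in> M" "y \<in> M" shows "d x y = d y x"
proof -
  have "(-1) \<odot> (x \<ominus> y) = y \<ominus> x"
    using assms by (simp add: bm_diff_def scale_add_right scale_scale scale_one closed add_commute)
  then show ?thesis using norm_scale[of "x \<ominus> y" "-1"] assms by (simp add: closed)
qed

lemma d_triangle: "x \<in> M \<Longrightarrow> y \<in> M \<Longrightarrow> z \<in> M \<Longrightarrow> d x z \<le> d x y + d y z"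
  using norm_triangle[of "x \<ominus> y" "y \<ominus> z"] by (simp add: diff_add_diff closed)

lemma left_bound: obtains K where "K \<ge> 0" "\<And>a x. x \<in> M \<Longrightarrow> N (a \<rightharpoonup> x) \<le> K * norm a * N x"
proof -
  obtain K where K: "\<And>a x. x \<in> M \<Longrightarrow> N (a \<rightharpoonup> x) \<le> K * norm a * N x"
    using left_bounded by blast
  have "K * norm a * N x \<le> max K 0 * norm a * N x" if "x \<in> M" for a :: 'a and x
    using norm_ge0[OF that] by (intro mult_right_mono) auto
  with K have "\<And>a x. x \<in> M \<Longrightarrow> N (a \<rightharpoonup> x) \<le> max K 0 * norm a * N x"
    using order_trans by blast
  then show ?thesis by (intro that[of "max K 0"]) auto
qed

lemma right_bound: obtains K where "K \<ge> 0" "\<And>a x. x \<in> M \<Longrightarrow> N (x \<leftharpoonup> a) \<le> K * norm a * N x"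
proof -
  obtain K where K: "\<And>a x. x \<in> M \<Longrightarrow> N (x \<leftharpoonup> a) \<le> K * norm a * N x"
    using right_bounded by blast
  have "K * norm a * N x \<le> max K 0 * norm a * N x" if "x \<in> M" for a :: 'a and x
    using norm_ge0[OF that] by (intro mult_right_mono) auto
  with K have "\<And>a x. x \<in> M \<Longrightarrow> N (x \<leftharpoonup> a) \<le> max K 0 * norm a * N x"
    using order_trans by blast
  then show ?thesis by (intro that[of "max K 0"]) auto
qed

lemma sub_bimodule:
  assumes "S \<subseteq> M" "\<zero> \<in> S"
    and "\<And>x y. x \<in> S \<Longrightarrow> y \<in> S \<Longrightarrow> x \<oplus> y \<in> S"
    and "\<And>c x. x \<in> S \<Longrightarrow> c \<odot> x \<in> S"
    and "\<And>a x. x \<in> S \<Longrightarrow> a \<rightharpoonup> x \<in> S" "\<And>a x. x \<in> S \<Longrightarrow> x \<leftharpoonup> a \<in> S"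
    and closed: "\<And>x. x \<in> M \<Longrightarrow> (\<And>e. e > 0 \<Longrightarrow> \<exists>y\<in>S. d y x < e) \<Longrightarrow> x \<in> S"
  shows "banach_bimodule (E\<lparr>bm_carrier := S\<rparr>)"
proof -
  have [simp]: "bm_diff (E\<lparr>bm_carrier := S\<rparr>) = bm_diff E" by (simp add: bm_diff_def fun_eq_iff)
  have SM: "x \<in> M" if "x \<in> S" for x using assms(1) that by blast
  show ?thesis
  proof (unfold_locales, simp_all add: assms(2-6))
    fix X :: "nat \<Rightarrow> 'e"
    assume X: "\<forall>n. X n \<in> S" and "\<forall>e>0. \<exists>N. \<forall>m\<ge>N. \<forall>n\<ge>N. d (X m) (X n) < e"
    then obtain x where x: "x \<in> M" "(\<lambda>n. d (X n) x) \<longlonglongrightarrow> 0"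
      using complete[of X] SM by blast
    have "\<exists>y\<in>S. d y x < e" if "e > 0" for e
    proof -
      have "\<forall>\<^sub>F n in sequentially. d (X n) x < e" using order_tendstoD(2)[OF x(2) that] .
      then obtain n where "d (X n) x < e" by (meson eventually_sequentially order_refl)
      then show ?thesis using X by blast
    qed
    then have "x \<in> S" using closed[OF x(1)] by blast
    with x(2) show "\<exists>x\<in>S. (\<lambda>n. d (X n) x) \<longlonglongrightarrow> 0" by blast
  next
    show "\<exists>K. \<forall>a. \<forall>x\<in>S. N (a \<rightharpoonup> x) \<le> K * norm a * N x" using left_bounded SM by blast
    show "\<exists>K. \<forall>a. \<forall>x\<in>S. N (x \<leftharpoonup> a) \<le> K * norm a * N x" using right_bounded SM by blast
  qed (use SM in \<open>auto simp: diff_self add_zero scale_one norm_eq_zero norm_scale norm_triangle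
      scale_add_right scale_add_left scale_scale left_add_right left_add_left left_scale_right
      left_scale_left right_add_left right_add_right right_scale_left right_scale_right
      left_left right_right left_right intro: add_assoc add_commute\<close>)
qed

definition image_bimodule :: "('e \<Rightarrow> 'f) \<Rightarrow> ('a, 'f) bimodule" where
  "image_bimodule g =
    (let h = inv_into M g in
     \<lparr>bm_carrier = g ` M, bm_zero = g \<zero>, bm_add = (\<lambda>x y. g (h x \<oplus> h y)),
      bm_scale = (\<lambda>c x. g (c \<odot> h x)), bm_norm = (\<lambda>x. N (h x)),
      bm_left = (\<lambda>a x. g (a \<rightharpoonup> h x)), bm_right = (\<lambda>x a. g (h x \<leftharpoonup> a))\<rparr>)"

context
  fixes g :: "'e \<Rightarrow> 'f"
  assumes g: "inj_on g M"
begin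

lemma image_bimodule_simps:
  "bm_carrier (image_bimodule g) = g ` M"
  "bm_zero (image_bimodule g) = g \<zero>"
  "x \<in> M \<Longrightarrow> y \<in> M \<Longrightarrow> bm_add (image_bimodule g) (g x) (g y) = g (x \<oplus> y)"
  "x \<in> M \<Longrightarrow> bm_scale (image_bimodule g) c (g x) = g (c \<odot> x)"
  "x \<in> M \<Longrightarrow> bm_norm (image_bimodule g) (g x) = N x"
  "x \<in> M \<Longrightarrow> bm_left (image_bimodule g) a (g x) = g (a \<rightharpoonup> x)"
  "x \<in> M \<Longrightarrow> bm_right (image_bimodule g) (g x) a = g (x \<leftharpoonup> a)"
  using g by (simp_all add: image_bimodule_def Let_def)

lemma image_bimodule_diff:
  "x \<in> M \<Longrightarrow> y \<in> M \<Longrightarrow> bm_diff (image_bimodule g) (g x) (g y) = g (x \<ominus> y)"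
  by (simp add: bm_diff_def image_bimodule_simps closed)

lemma image_bimodule: "banach_bimodule (image_bimodule g)"
proof (unfold_locales, unfold image_bimodule_simps(1,2))
  fix X :: "nat \<Rightarrow> 'f"
  let ?E = "image_bimodule g"
  assume "\<forall>n. X n \<in> g ` M" and C: "\<forall>e>0. \<exists>N. \<forall>m\<ge>N. \<forall>n\<ge>N. bm_norm ?E (bm_diff ?E (X m) (X n)) < e"
  then have "\<forall>n. \<exists>y. y \<in> M \<and> X n = g y" by blast
  then obtain Y where Y: "\<And>n. Y n \<in> M" "\<And>n. X n = g (Y n)" by metis
  have "\<forall>e>0. \<exists>N. \<forall>m\<ge>N. \<forall>n\<ge>N. d (Y m) (Y n) < e"
    using C by (simp add: Y image_bimodule_diff image_bimodule_simps closed)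
  then obtain y where y: "y \<in> M" "(\<lambda>n. d (Y n) y) \<longlonglongrightarrow> 0"
    using complete[of Y] Y(1) by blast
  then show "\<exists>x\<in>g ` M. (\<lambda>n. bm_norm ?E (bm_diff ?E (X n) x)) \<longlonglongrightarrow> 0"
    by (intro bexI[of _ "g y"]) (simp_all add: Y image_bimodule_diff image_bimodule_simps closed)
next
  show "\<exists>K. \<forall>a. \<forall>x\<in>g ` M. bm_norm (image_bimodule g) (bm_left (image_bimodule g) a x)
      \<le> K * norm a * bm_norm (image_bimodule g) x"
    using left_bounded by (simp add: image_bimodule_simps closed)
  show "\<exists>K. \<forall>a. \<forall>x\<in>g ` M. bm_norm (image_bimodule g) (bm_right (image_bimodule g) x a)
      \<le> K * norm a * bm_norm (image_bimodule g) x"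
    using right_bounded by (simp add: image_bimodule_simps closed)
qed (auto simp: image_bimodule_simps image_bimodule_diff closed diff_self add_zero scale_one
      norm_scale norm_triangle norm_eq_zero inj_on_eq_iff[OF g]
      scale_add_right scale_add_left scale_scale left_add_right left_add_left left_scale_right
      left_scale_left right_add_left right_add_right right_scale_left right_scale_right
      left_left right_right left_right add_assoc intro: arg_cong[where f = g] add_commute)

lemma derivation_image:
  assumes "derivation E D"
  shows "derivation (image_bimodule g) (g \<circ> D)"
  using assms by (auto simp: derivation_def image_bimodule_simps closed)

lemma inner_derivation_image:
  assumes "derivation E D" "inner_derivation (image_bimodule g) (g \<circ> D)"
  shows "inner_derivation E D"
  using assms
  by (auto simp: inner_derivation_def derivation_def image_bimodule_simps image_bimodule_diff
      closed inj_on_eq_iff[OF g])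

end

context
  fixes D assumes D: "derivation E D"
begin

lemma D_closed: "D a \<in> M"
  and D_add: "D (a + b) = D a \<oplus> D b"
  and D_scale: "D (c *\<^sub>C a) = c \<odot> D a"
  and D_mult: "D (a * b) = (D a \<leftharpoonup> b) \<oplus> (a \<rightharpoonup> D b)"
  using D by (auto simp: derivation_def)

lemma D_zero: "D 0 = \<zero>"
  using D_scale[of 0 0] by (simp add: scale_zero_left D_closed)

definition comb :: "('a \<times> 'a) list \<Rightarrow> 'e" where
  "comb xs = foldr (\<lambda>(b, c) y. (b \<rightharpoonup> D c) \<oplus> y) xs \<zero>"

lemma comb_simps: "comb [] = \<zero>" "comb ((b, c) # xs) = (b \<rightharpoonup> D c) \<oplus> comb xs"
  by (simp_all add: comb_def)

lemma comb_closed: "comb xs \<in> M"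
  by (induction xs) (auto simp: comb_simps closed D_closed)

lemma comb_append: "comb (xs @ ys) = comb xs \<oplus> comb ys"
  by (induction xs) (auto simp: comb_simps add_zero add_assoc comb_closed closed D_closed)

lemma comb_scale: "c \<odot> comb xs = comb (map (\<lambda>(a, b). (c *\<^sub>C a, b)) xs)"
  by (induction xs)
    (auto simp: comb_simps scale_zero_right scale_add_right left_scale_left comb_closed closed D_closed)

lemma comb_left: "a \<rightharpoonup> comb xs = comb (map (\<lambda>(b, c). (a * b, c)) xs)"
  by (induction xs)
    (auto simp: comb_simps left_zero left_add_right left_left comb_closed closed D_closed)

lemma D_right: "D a \<leftharpoonup> b = D (a * b) \<oplus> comb [(- a, b)]"
proof -
  have "(- a) \<rightharpoonup> D b = (-1) \<odot> (a \<rightharpoonup> D b)"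
    using left_scale_left[of "D b" "-1" a] by (simp add: scaleC_minus_one D_closed)
  then show ?thesis
    using diff_self[of "a \<rightharpoonup> D b"]
    by (simp add: comb_simps D_mult zero_right add_assoc closed D_closed bm_diff_def)
qed

lemma comb_right: "\<exists>ys. comb xs \<leftharpoonup> a = comb ys"
proof (induction xs)
  case Nil
  show ?case by (rule exI[of _ "[]"]) (simp add: comb_simps right_zero)
next
  case (Cons x xs)
  obtain b c where x: "x = (b, c)" by force
  obtain ys where ys: "comb xs \<leftharpoonup> a = comb ys" using Cons by blast
  have "(b \<rightharpoonup> D c) \<leftharpoonup> a = (b \<rightharpoonup> D (c * a)) \<oplus> (b \<rightharpoonup> comb [(- c, a)])"
    by (simp add: left_right D_right left_add_right comb_closed closed D_closed)
  also have "\<dots> = comb [(b, c * a), (b * - c, a)]"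
    by (simp add: comb_left) (simp add: comb_simps zero_right closed D_closed)
  finally have "comb (x # xs) \<leftharpoonup> a = comb ([(b, c * a), (b * - c, a)] @ ys)"
    by (simp only: x comb_simps(2) comb_append right_add_left comb_closed closed D_closed ys)
  then show ?case by blast
qed

definition gen :: "'a \<times> ('a \<times> 'a) list \<Rightarrow> 'e" where
  "gen p = D (fst p) \<oplus> comb (snd p)"

lemma gen_closed: "gen p \<in> M"
  by (simp add: gen_def closed D_closed comb_closed)

lemma gen_add: "gen p \<oplus> gen q = gen (fst p + fst q, snd p @ snd q)"
  by (simp add: gen_def D_add comb_append add_assoc add_left_commute closed D_closed comb_closed)

lemma gen_scale: "c \<odot> gen p = gen (c *\<^sub>C fst p, map (\<lambda>(a, b). (c *\<^sub>C a, b)) (snd p))"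
  by (simp add: gen_def D_scale comb_scale scale_add_right closed D_closed comb_closed)

lemma gen_left: "a \<rightharpoonup> gen p = gen (0, (a, fst p) # map (\<lambda>(b, c). (a * b, c)) (snd p))"
  by (simp add: gen_def D_zero comb_left left_add_right comb_simps add_zero closed D_closed comb_closed)

lemma gen_right: "\<exists>q. gen p \<leftharpoonup> a = gen q"
proof -
  obtain ys where "comb (snd p) \<leftharpoonup> a = comb ys" using comb_right by blast
  then have "gen p \<leftharpoonup> a = gen (fst p * a, [(- fst p, a)] @ ys)"
    by (simp only: gen_def D_right comb_append right_add_left add_assoc fst_conv snd_conv closed D_closed comb_closed)
  then show ?thesis by blast
qed

definition span_closure :: "'e set" where
  "span_closure = {x \<in> M. \<forall>e>0. \<exists>p. d (gen p) x < e}"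

lemma d_self: "x \<in> M \<Longrightarrow> d x x = 0"
  by (simp add: diff_self norm_eq_zero closed)

lemma gen_in_closure: "gen p \<in> span_closure"
  unfolding span_closure_def
proof (intro CollectI conjI allI impI)
  fix e :: real assume "e > 0"
  then show "\<exists>q. d (gen q) (gen p) < e" by (intro exI[of _ p]) (simp add: d_self gen_closed)
qed (rule gen_closed)

lemma span_closureD: "x \<in> span_closure \<Longrightarrow> e > 0 \<Longrightarrow> \<exists>p. d (gen p) x < e"
  unfolding span_closure_def by blast

lemma span_closure_step:
  assumes K: "K \<ge> 0" and x: "x \<in> span_closure" and fx: "f x \<in> M"
    and f: "\<And>p. \<exists>q. f (gen p) = gen q" "\<And>p. d (f (gen p)) (f x) \<le> K * d (gen p) x"
  shows "f x \<in> span_closure"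
proof -
  have "\<exists>p. d (gen p) (f x) < e" if "e > 0" for e
  proof -
    have "0 < e / (K + 1)" using that K by simp
    then obtain p where p: "d (gen p) x < e / (K + 1)" using span_closureD[OF x] by blast
    obtain q where q: "f (gen p) = gen q" using f(1) by blast
    have "0 \<le> d (gen p) x" using x by (intro norm_ge0 closed gen_closed) (simp add: span_closure_def)
    then have "K * d (gen p) x \<le> (K + 1) * d (gen p) x" by (intro mult_right_mono) auto
    also have "\<dots> < e" using p K by (simp add: pos_less_divide_eq mult.commute)
    finally have "d (f (gen p)) (f x) < e" using f(2)[of p] by linarith
    then show ?thesis unfolding q by blast
  qed
  then show ?thesis using fx by (simp add: span_closure_def)
qed

lemma banach_bimodule_span_closure: "banach_bimodule (E\<lparr>bm_carrier := span_closure\<rparr>)"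
proof (rule sub_bimodule)
  show "span_closure \<subseteq> M" by (auto simp: span_closure_def)
  show "\<zero> \<in> span_closure"
    using gen_in_closure[of "(0, [])"] by (simp add: gen_def D_zero comb_simps zero_right closed)
next
  fix x y assume x: "x \<in> span_closure" and y: "y \<in> span_closure"
  then have M: "x \<in> M" "y \<in> M" by (auto simp: span_closure_def)
  have "\<exists>p. d (gen p) (x \<oplus> y) < e" if "e > 0" for e
  proof -
    have e: "0 < e / 2" using that by simp
    obtain p where p: "d (gen p) x < e / 2" using span_closureD[OF x e] by blast
    obtain q where q: "d (gen q) y < e / 2" using span_closureD[OF y e] by blast
    have "d (gen p \<oplus> gen q) (x \<oplus> y) \<le> d (gen p) x + d (gen q) y"
      using norm_triangle[of "gen p \<ominus> x" "gen q \<ominus> y"] M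
      by (simp add: add_diff_interchange gen_closed closed)
    then have "d (gen p \<oplus> gen q) (x \<oplus> y) < e" using p q by linarith
    then show ?thesis unfolding gen_add by blast
  qed
  then show "x \<oplus> y \<in> span_closure" using M by (simp add: span_closure_def closed)
next
  fix c x assume x: "x \<in> span_closure"
  then have M: "x \<in> M" by (auto simp: span_closure_def)
  show "c \<odot> x \<in> span_closure"
    using M by (intro span_closure_step[OF _ x, where K = "cmod c"])
      (auto simp: gen_scale[symmetric] scale_diff[symmetric] norm_scale gen_closed closed intro: gen_scale)
next
  fix a x assume x: "x \<in> span_closure"
  then have M: "x \<in> M" by (auto simp: span_closure_def)
  obtain K where K: "K \<ge> 0" "\<And>a x. x \<in> M \<Longrightarrow> N (a \<rightharpoonup> x) \<le> K * norm a * N x" using left_bound by blast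
  show "a \<rightharpoonup> x \<in> span_closure"
    using M K by (intro span_closure_step[OF _ x, where K = "K * norm a"])
      (auto simp: left_diff[symmetric] gen_closed closed intro: gen_left)
  obtain K where K: "K \<ge> 0" "\<And>a x. x \<in> M \<Longrightarrow> N (x \<leftharpoonup> a) \<le> K * norm a * N x" using right_bound by blast
  show "x \<leftharpoonup> a \<in> span_closure"
    using M K by (intro span_closure_step[OF _ x, where K = "K * norm a" and f = "\<lambda>x. x \<leftharpoonup> a"] gen_right)
      (auto simp: right_diff[symmetric] gen_closed closed)
next
  fix x assume x: "x \<in> M" and *: "\<And>e. e > 0 \<Longrightarrow> \<exists>y\<in>span_closure. d y x < e"
  have "\<exists>p. d (gen p) x < e" if "e > 0" for e
  proof -
    have e: "0 < e / 2" using that by simp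
    obtain y where y: "y \<in> span_closure" "d y x < e / 2" using *[OF e] by blast
    then obtain p where "d (gen p) y < e / 2" using span_closureD[OF _ e] by blast
    with y d_triangle[of "gen p" y x] x show ?thesis
      by (intro exI[of _ p]) (simp add: span_closure_def gen_closed)
  qed
  then show "x \<in> span_closure" using x by (simp add: span_closure_def)
qed

definition code :: "'e \<Rightarrow> nat \<Rightarrow> 'a \<times> ('a \<times> 'a) list" where
  "code x n = (SOME p. d (gen p) x < 1 / Suc n)"

lemma inj_on_code: "inj_on code span_closure"
proof (rule inj_onI)
  fix x y assume x: "x \<in> span_closure" and y: "y \<in> span_closure" and eq: "code x = code y"
  then have M: "x \<in> M" "y \<in> M" by (auto simp: span_closure_def)
  have code: "d (gen (code z n)) z < 1 / Suc n" if "z \<in> span_closure" for z n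
  proof -
    have "\<exists>p. d (gen p) z < 1 / Suc n" using span_closureD[OF that] by simp
    then show ?thesis unfolding code_def by (rule someI_ex)
  qed
  have le: "d x y \<le> 2 * inverse (real (Suc n))" for n
    using d_triangle[of x "gen (code x n)" y] code[OF x, of n] code[OF y, of n] M
    by (simp add: eq d_commute[of x] gen_closed inverse_eq_divide)
  have "(\<lambda>n. 2 * inverse (real (Suc n))) \<longlonglongrightarrow> 0"
    using tendsto_mult_left[OF LIMSEQ_inverse_real_of_nat, of 2] by simp
  then have "d x y \<le> 0" by (rule LIMSEQ_le_const) (use le in blast)
  then have "x \<ominus> y = \<zero>" using M norm_ge0[of "x \<ominus> y"] norm_eq_zero[of "x \<ominus> y"] by (simp add: closed)
  then show "x = y" using M by (simp add: diff_eq_zero)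
qed

lemma derivation_span_closure: "derivation (E\<lparr>bm_carrier := span_closure\<rparr>) D"
proof -
  have "D a \<in> span_closure" for a
    using gen_in_closure[of "(a, [])"] by (simp add: gen_def comb_simps zero_right D_closed)
  then show ?thesis using D by (simp add: derivation_def)
qed

lemma inner_span_closure:
  assumes "inner_derivation (E\<lparr>bm_carrier := span_closure\<rparr>) D"
  shows "inner_derivation E D"
  using assms by (auto simp: inner_derivation_def bm_diff_def span_closure_def)

end

end

theorem contractible_algebraD:
  fixes E :: "('a :: complex_banach_algebra, 'e) bimodule"
  assumes "contractible_algebra TYPE('a)" "banach_bimodule E" "derivation E D"
  shows "inner_derivation E D"
proof -
  interpret E: banach_bimodule E by fact
  let ?S = "E\<lparr>bm_carrier := E.span_closure D\<rparr>"
  interpret S: banach_bimodule ?S by (rule E.banach_bimodule_span_closure[OF assms(3)])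
  have D: "derivation ?S D" by (rule E.derivation_span_closure[OF assms(3)])
  have inj: "inj_on (E.code D) (bm_carrier ?S)" using E.inj_on_code[OF assms(3)] by simp
  have "inner_derivation (S.image_bimodule (E.code D)) (E.code D \<circ> D)"
    using assms(1) S.image_bimodule[OF inj] S.derivation_image[OF inj D]
    unfolding contractible_algebra_def by blast
  then have "inner_derivation ?S D" by (rule S.inner_derivation_image[OF inj D])
  then show ?thesis by (rule E.inner_span_closure[OF assms(3)])
qed

section \<open>Biprojectivity and biflatness\<close>

definition bimodule_hom ::
    "('a \<Rightarrow> 'x :: complex_banach \<Rightarrow> 'x) \<Rightarrow> ('x \<Rightarrow> 'a \<Rightarrow> 'x) \<Rightarrow>
     ('a \<Rightarrow> 'y :: complex_banach \<Rightarrow> 'y) \<Rightarrow> ('y \<Rightarrow> 'a \<Rightarrow> 'y) \<Rightarrow> ('x \<Rightarrow> 'y) \<Rightarrow> bool" where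
  "bimodule_hom lX rX lY rY T \<longleftrightarrow>
     bounded_clinear T \<and> (\<forall>a x. T (lX a x) = lY a (T x)) \<and> (\<forall>x a. T (rX x a) = rY (T x) a)"

definition diagonal :: "('a :: complex_banach_algebra, 'a) ptensor \<Rightarrow> 'a" where
  "diagonal = ptensor_lift (*)"

definition tensor_left :: "'a :: complex_banach_algebra \<Rightarrow> ('a, 'a) ptensor \<Rightarrow> ('a, 'a) ptensor" where
  "tensor_left a = ptensor_lift (\<lambda>b c. (a * b) \<otimes>\<^sub>\<pi> c)"

definition tensor_right :: "('a :: complex_banach_algebra, 'a) ptensor \<Rightarrow> 'a \<Rightarrow> ('a, 'a) ptensor" where
  "tensor_right u a = ptensor_lift (\<lambda>b c. b \<otimes>\<^sub>\<pi> (c * a)) u"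

text \<open>The dual bimodule: \<open>(a \<cdot> f) x = f (x \<cdot> a)\<close> and \<open>(f \<cdot> a) x = f (a \<cdot> x)\<close>.\<close>

definition dual_left :: "('x :: complex_banach \<Rightarrow> 'a \<Rightarrow> 'x) \<Rightarrow> 'a \<Rightarrow> 'x dual \<Rightarrow> 'x dual" where
  "dual_left rX a f = adjoint_map (\<lambda>x. rX x a) f"

definition dual_right :: "('a \<Rightarrow> 'x :: complex_banach \<Rightarrow> 'x) \<Rightarrow> 'x dual \<Rightarrow> 'a \<Rightarrow> 'x dual" where
  "dual_right lX f a = adjoint_map (\<lambda>x. lX a x) f"

lemma bounded_cbilinear_mult: "bounded_cbilinear ((*) :: 'a :: complex_banach_algebra \<Rightarrow> _)"
  by (simp add: bounded_cbilinear_def bounded_bilinear_mult scaleC_mult_left scaleC_mult_right)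

lemma bounded_clinear_mult_left: "bounded_clinear (\<lambda>x :: 'a :: complex_banach_algebra. a * x)"
  by (simp add: bounded_clinear_def bounded_linear_mult_right scaleC_mult_right)

lemma bounded_clinear_mult_right: "bounded_clinear (\<lambda>x :: 'a :: complex_banach_algebra. x * a)"
  by (simp add: bounded_clinear_def bounded_linear_mult_left scaleC_mult_left)

lemma bounded_cbilinear_compose:
  assumes f: "bounded_cbilinear f" and S: "bounded_clinear S" and T: "bounded_clinear T"
  shows "bounded_cbilinear (\<lambda>a b. f (S a) (T b))"
  using assms bounded_bilinear.comp[of f S T] by (simp add: bounded_cbilinear_def bounded_clinear_def)

lemma bounded_clinear_id: "bounded_clinear (\<lambda>x. x)"
  by (simp add: bounded_clinear_def bounded_linear_ident)

lemma bounded_clinear_diagonal: "bounded_clinear diagonal"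
  and diagonal_ptens: "diagonal (a \<otimes>\<^sub>\<pi> b) = a * b"
  unfolding diagonal_def
  by (rule bounded_clinear_ptensor_lift[OF bounded_cbilinear_mult] ptensor_lift_ptens[OF bounded_cbilinear_mult])+

lemma bounded_clinear_tensor_left: "bounded_clinear (tensor_left a)"
  and tensor_left_ptens: "tensor_left a (b \<otimes>\<^sub>\<pi> c) = (a * b) \<otimes>\<^sub>\<pi> c"
proof -
  have f: "bounded_cbilinear (\<lambda>b c. (a * b) \<otimes>\<^sub>\<pi> c)"
    by (rule bounded_cbilinear_compose[OF bounded_cbilinear_ptens bounded_clinear_mult_left bounded_clinear_id])
  show "bounded_clinear (tensor_left a)" "tensor_left a (b \<otimes>\<^sub>\<pi> c) = (a * b) \<otimes>\<^sub>\<pi> c"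
    unfolding tensor_left_def by (rule bounded_clinear_ptensor_lift[OF f] ptensor_lift_ptens[OF f])+
qed

lemma bounded_clinear_tensor_right: "bounded_clinear (\<lambda>u. tensor_right u a)"
  and tensor_right_ptens: "tensor_right (b \<otimes>\<^sub>\<pi> c) a = b \<otimes>\<^sub>\<pi> (c * a)"
proof -
  have f: "bounded_cbilinear (\<lambda>b c. b \<otimes>\<^sub>\<pi> (c * a))"
    by (rule bounded_cbilinear_compose[OF bounded_cbilinear_ptens bounded_clinear_id bounded_clinear_mult_right])
  show "bounded_clinear (\<lambda>u. tensor_right u a)" "tensor_right (b \<otimes>\<^sub>\<pi> c) a = b \<otimes>\<^sub>\<pi> (c * a)"
    unfolding tensor_right_def by (rule bounded_clinear_ptensor_lift[OF f] ptensor_lift_ptens[OF f])+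
qed

text \<open>\<open>A\<close> is biprojective if the diagonal operator has a bounded \<open>A\<close>-bimodule right inverse, and
  biflat if its adjoint has a bounded \<open>A\<close>-bimodule left inverse.\<close>

definition biprojective :: "'a :: complex_banach_algebra itself \<Rightarrow> bool" where
  "biprojective _ \<longleftrightarrow>
     (\<exists>\<rho> :: 'a \<Rightarrow> ('a, 'a) ptensor.
        bimodule_hom (*) (*) tensor_left tensor_right \<rho> \<and> (\<forall>a. diagonal (\<rho> a) = a))"

definition biflat :: "'a :: complex_banach_algebra itself \<Rightarrow> bool" where
  "biflat _ \<longleftrightarrow>
     (\<exists>\<Lambda> :: ('a, 'a) ptensor dual \<Rightarrow> 'a dual.
        bimodule_hom (dual_left tensor_right) (dual_right tensor_left) (dual_left (*)) (dual_right (*)) \<Lambda> \<and>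
        (\<forall>f. \<Lambda> (adjoint_map diagonal f) = f))"

section \<open>Retractions of Banach algebras\<close>

definition continuous_algebra_hom ::
    "('a :: complex_banach_algebra \<Rightarrow> 'b :: complex_banach_algebra) \<Rightarrow> bool" where
  "continuous_algebra_hom \<phi> \<longleftrightarrow>
     continuous_on UNIV \<phi> \<and> (\<forall>a b. \<phi> (a + b) = \<phi> a + \<phi> b) \<and>
     (\<forall>c a. \<phi> (c *\<^sub>C a) = c *\<^sub>C \<phi> a) \<and> (\<forall>a b. \<phi> (a * b) = \<phi> a * \<phi> b)"

definition algebra_retraction ::
    "('a :: complex_banach_algebra \<Rightarrow> 'b :: complex_banach_algebra) \<Rightarrow> bool" where
  "algebra_retraction \<phi> \<longleftrightarrow>
     continuous_algebra_hom \<phi> \<and> (\<exists>\<psi>. continuous_algebra_hom \<psi> \<and> \<phi> \<circ> \<psi> = id)"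

end

theory Submission
  imports Defs
begin

text \<open>
  Let \<open>\<psi>\<close> be a homomorphic section of \<open>\<phi>\<close>. Restricting scalars along \<open>\<psi>\<close> turns every Banach
  \<open>A\<close>-bimodule \<open>X\<close> into a \<open>B\<close>-bimodule \<open>X\<^sub>\<psi>\<close> and every \<open>A\<close>-bimodule map into a
  \<open>B\<close>-bimodule map. Two maps compare the restricted modules with those of \<open>B\<close>: since \<open>\<psi>\<close> is multiplicative, it is a bimodule
  map \<open>B \<rightarrow> A\<^sub>\<psi>\<close>; since \<open>\<phi>\<close> is multiplicative and \<open>\<phi> \<circ> \<psi> = id\<close>, the map \<open>\<phi> \<otimes> \<phi>\<close> is a bimodule map
  \<open>(A \<otimes> A)\<^sub>\<psi> \<rightarrow> B \<otimes> B\<close> (\<open>tensor_map_bimodule_hom\<close>). Multiplicativity of \<open>\<phi>\<close> also gives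
  \<open>\<pi>\<^sub>B \<circ> (\<phi> \<otimes> \<phi>) = \<phi> \<circ> \<pi>\<^sub>A\<close> (\<open>diagonal_tensor_map\<close>).

  A bimodule right inverse \<open>\<rho>\<close> of \<open>\<pi>\<^sub>A\<close> therefore gives the bimodule map
  \<open>(\<phi> \<otimes> \<phi>) \<circ> \<rho> \<circ> \<psi>\<close>, and \<open>\<pi>\<^sub>B \<circ> (\<phi> \<otimes> \<phi>) \<circ> \<rho> \<circ> \<psi> = \<phi> \<circ> \<pi>\<^sub>A \<circ> \<rho> \<circ> \<psi> = \<phi> \<circ> \<psi> = id\<close>. Dually, a
  bimodule left inverse \<open>\<Lambda>\<close> of \<open>\<pi>\<^sub>A\<^sup>*\<close> gives \<open>\<psi>\<^sup>* \<circ> \<Lambda> \<circ> (\<phi> \<otimes> \<phi>)\<^sup>*\<close>, which is a bimodule map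
  because adjoints of bimodule maps are bimodule maps between the dual modules, and
  \<open>\<psi>\<^sup>* \<circ> \<Lambda> \<circ> (\<phi> \<otimes> \<phi>)\<^sup>* \<circ> \<pi>\<^sub>B\<^sup>* = \<psi>\<^sup>* \<circ> \<Lambda> \<circ> \<pi>\<^sub>A\<^sup>* \<circ> \<phi>\<^sup>* = (\<phi> \<circ> \<psi>)\<^sup>* = id\<close>.

  Contractibility passes to the image of any surjective homomorphism \<open>\<phi>\<close>: restricting a
  \<open>B\<close>-bimodule along \<open>\<phi>\<close> makes \<open>D \<circ> \<phi>\<close> a derivation of \<open>A\<close>, and an element that implements
  \<open>D \<circ> \<phi>\<close> implements \<open>D\<close> on the range of \<open>\<phi>\<close>.
\<close>

section \<open>Bounded linear maps, adjoints and tensor maps\<close>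

lemma bounded_clinear_compose:
  "bounded_clinear S \<Longrightarrow> bounded_clinear T \<Longrightarrow> bounded_clinear (\<lambda>x. S (T x))"
  by (auto simp: bounded_clinear_def intro: bounded_linear_compose)

text \<open>Continuity at \<open>0\<close> bounds an additive homogeneous map on a small ball, and homogeneity
  spreads the bound to the whole space.\<close>

lemma continuous_algebra_hom_bounded_clinear:
  assumes "continuous_algebra_hom \<phi>"
  shows "bounded_clinear \<phi>"
proof -
  from assms have cont: "continuous_on UNIV \<phi>" and add: "\<And>a b. \<phi> (a + b) = \<phi> a + \<phi> b"
    and scale: "\<And>c a. \<phi> (c *\<^sub>C a) = c *\<^sub>C \<phi> a"
    by (auto simp: continuous_algebra_hom_def)
  have zero: "\<phi> 0 = 0" using add[of 0 0] by simp
  have scaleR: "\<phi> (r *\<^sub>R a) = r *\<^sub>R \<phi> a" for r a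
    using scale[of "complex_of_real r" a] by (simp add: scaleC_of_real)
  have "isCont \<phi> 0" using cont by (simp add: continuous_on_eq_continuous_at)
  then obtain d where d: "d > 0" "\<And>a. norm a < d \<Longrightarrow> norm (\<phi> a) < 1"
    unfolding continuous_at_eps_delta dist_norm zero by (metis diff_zero zero_less_one)
  have "norm (\<phi> a) \<le> norm a * (2 / d)" for a
  proof (cases "a = 0")
    case False
    define r where "r = d / (2 * norm a)"
    have r: "r > 0" using d False by (simp add: r_def)
    have "norm (r *\<^sub>R a) < d" using d False by (simp add: r_def)
    then have "r * norm (\<phi> a) < 1" using d(2)[of "r *\<^sub>R a"] r by (simp add: scaleR)
    then show ?thesis using d(1) False by (simp add: r_def field_simps)
  qed (simp add: zero)
  then have "bounded_linear \<phi>" by (intro bounded_linear_intro add scaleR)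
  then show ?thesis by (simp add: bounded_clinear_def scale)
qed

lemma dual_eqI: "(\<And>x. dual_apply f x = dual_apply g x) \<Longrightarrow> f = g"
  by (simp add: dual_apply_inject[symmetric] fun_eq_iff)

lemma dual_apply_plus: "dual_apply (f + g) x = dual_apply f x + dual_apply g x"
  by transfer simp

lemma dual_apply_scaleR: "dual_apply (r *\<^sub>R f) x = r *\<^sub>R dual_apply f x"
  by transfer simp

lemma dual_apply_scaleC: "dual_apply (c *\<^sub>C f) x = c * dual_apply f x"
  by transfer simp

lemma bounded_clinear_adjoint_map:
  assumes T: "bounded_clinear T"
  shows "bounded_clinear (adjoint_map T)"
proof -
  note apply_T = dual_apply_adjoint_map[OF T]
  have "norm (adjoint_map T f) \<le> norm f * onorm T" for f
  proof -
    have "bounded_linear (dual_apply f)" "bounded_linear T"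
      using T bounded_clinear_dual_apply[of f] by (auto simp: bounded_clinear_def)
    then have "onorm (dual_apply f \<circ> T) \<le> onorm (dual_apply f) * onorm T" by (rule onorm_compose)
    moreover have "dual_apply f \<circ> T = dual_apply (adjoint_map T f)" by (simp add: fun_eq_iff apply_T)
    ultimately show ?thesis by (simp add: norm_dual.rep_eq)
  qed
  then have "bounded_linear (adjoint_map T)"
    by (intro bounded_linear_intro dual_eqI) (simp_all add: apply_T dual_apply_plus dual_apply_scaleR)
  moreover have "adjoint_map T (c *\<^sub>C f) = c *\<^sub>C adjoint_map T f" for c f
    by (rule dual_eqI) (simp add: apply_T dual_apply_scaleC)
  ultimately show ?thesis by (simp add: bounded_clinear_def)
qed

lemma adjoint_map_compose:
  assumes "bounded_clinear S" "bounded_clinear T"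
  shows "adjoint_map T (adjoint_map S f) = adjoint_map (\<lambda>x. S (T x)) f"
  by (rule dual_eqI) (simp add: assms bounded_clinear_compose dual_apply_adjoint_map)

lemma adjoint_map_id: "adjoint_map (\<lambda>x. x) f = f"
  by (rule dual_eqI) (simp add: bounded_clinear_id dual_apply_adjoint_map)

definition tensor_map ::
    "('a :: complex_banach \<Rightarrow> 'c :: complex_banach) \<Rightarrow> ('b :: complex_banach \<Rightarrow> 'd :: complex_banach) \<Rightarrow>
     ('a, 'b) ptensor \<Rightarrow> ('c, 'd) ptensor" where
  "tensor_map S T = ptensor_lift (\<lambda>a b. S a \<otimes>\<^sub>\<pi> T b)"

lemma
  assumes "bounded_clinear S" "bounded_clinear T"
  shows bounded_clinear_tensor_map: "bounded_clinear (tensor_map S T)"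
    and tensor_map_ptens: "tensor_map S T (a \<otimes>\<^sub>\<pi> b) = S a \<otimes>\<^sub>\<pi> T b"
proof -
  have f: "bounded_cbilinear (\<lambda>a b. S a \<otimes>\<^sub>\<pi> T b)"
    by (rule bounded_cbilinear_compose[OF bounded_cbilinear_ptens assms])
  show "bounded_clinear (tensor_map S T)" "tensor_map S T (a \<otimes>\<^sub>\<pi> b) = S a \<otimes>\<^sub>\<pi> T b"
    unfolding tensor_map_def by (rule bounded_clinear_ptensor_lift[OF f] ptensor_lift_ptens[OF f])+
qed

section \<open>Bimodule homomorphisms and restriction of scalars\<close>

lemma bimodule_hom_compose:
  assumes "bimodule_hom lY rY lZ rZ S" "bimodule_hom lX rX lY rY T"
  shows "bimodule_hom lX rX lZ rZ (\<lambda>x. S (T x))"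
  using assms by (auto simp: bimodule_hom_def intro: bounded_clinear_compose)

lemma bimodule_hom_restrict:
  assumes "bimodule_hom lX rX lY rY T"
  shows "bimodule_hom (\<lambda>b. lX (\<psi> b)) (\<lambda>x b. rX x (\<psi> b)) (\<lambda>b. lY (\<psi> b)) (\<lambda>y b. rY y (\<psi> b)) T"
  using assms by (auto simp: bimodule_hom_def)

text \<open>Passing to adjoints reverses \<open>T (x \<cdot> a) = T x \<cdot> a\<close> into the compatibility of \<open>T\<^sup>*\<close> with the left
  dual actions, and the compatibility of \<open>T\<close> with the left actions into that of \<open>T\<^sup>*\<close> with the right
  ones.\<close>

lemma bimodule_hom_adjoint_map:
  assumes hom: "bimodule_hom lX rX lY rY T"
    and X: "\<And>a. bounded_clinear (lX a)" "\<And>a. bounded_clinear (\<lambda>x. rX x a)"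
    and Y: "\<And>a. bounded_clinear (lY a)" "\<And>a. bounded_clinear (\<lambda>y. rY y a)"
  shows "bimodule_hom (dual_left rY) (dual_right lY) (dual_left rX) (dual_right lX) (adjoint_map T)"
proof -
  have T: "bounded_clinear T" using hom by (simp add: bimodule_hom_def)
  show ?thesis
    using hom unfolding bimodule_hom_def dual_left_def dual_right_def
    by (simp add: bounded_clinear_adjoint_map adjoint_map_compose T X Y)
qed

lemma algebra_hom_bimodule_hom:
  assumes "continuous_algebra_hom \<psi>"
  shows "bimodule_hom (*) (*) (\<lambda>b x. \<psi> b * x) (\<lambda>x b. x * \<psi> b) \<psi>"
  using assms continuous_algebra_hom_bounded_clinear[OF assms]
  by (simp add: bimodule_hom_def continuous_algebra_hom_def)

text \<open>On elementary tensors, \<open>(\<phi> \<otimes> \<phi>) (\<psi> b \<cdot> (x \<otimes> y)) = \<phi> (\<psi> b) \<phi> x \<otimes> \<phi> y = b \<cdot> (\<phi> \<otimes> \<phi>) (x \<otimes> y)\<close>, and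
  bounded linear maps are determined by their values there.\<close>

lemma tensor_map_bimodule_hom:
  assumes \<phi>: "continuous_algebra_hom \<phi>" and inv: "\<And>b. \<phi> (\<psi> b) = b"
  shows "bimodule_hom (\<lambda>b. tensor_left (\<psi> b)) (\<lambda>u b. tensor_right u (\<psi> b)) tensor_left tensor_right
    (tensor_map \<phi> \<phi>)"
proof -
  note bdd = continuous_algebra_hom_bounded_clinear[OF \<phi>]
  note tbdd = bounded_clinear_tensor_map[OF bdd bdd]
  have mult: "\<phi> (x * y) = \<phi> x * \<phi> y" for x y using \<phi> by (simp add: continuous_algebra_hom_def)
  have "(\<lambda>u. tensor_map \<phi> \<phi> (tensor_left (\<psi> b) u)) = (\<lambda>u. tensor_left b (tensor_map \<phi> \<phi> u))" for b
    by (rule bounded_clinear_eq_on_ptens)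
      (simp_all add: bounded_clinear_compose tbdd bounded_clinear_tensor_left tensor_left_ptens
        tensor_map_ptens bdd mult inv)
  moreover have "(\<lambda>u. tensor_map \<phi> \<phi> (tensor_right u (\<psi> b))) = (\<lambda>u. tensor_right (tensor_map \<phi> \<phi> u) b)" for b
    by (rule bounded_clinear_eq_on_ptens)
      (simp_all add: bounded_clinear_compose[OF tbdd bounded_clinear_tensor_right]
        bounded_clinear_compose[OF bounded_clinear_tensor_right tbdd] tensor_right_ptens
        tensor_map_ptens bdd mult inv)
  ultimately show ?thesis using tbdd by (simp add: bimodule_hom_def fun_eq_iff)
qed

lemma diagonal_tensor_map:
  assumes \<phi>: "continuous_algebra_hom \<phi>"
  shows "diagonal (tensor_map \<phi> \<phi> u) = \<phi> (diagonal u)"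
proof -
  note bdd = continuous_algebra_hom_bounded_clinear[OF \<phi>]
  have mult: "\<phi> (x * y) = \<phi> x * \<phi> y" for x y using \<phi> by (simp add: continuous_algebra_hom_def)
  have "(\<lambda>u. diagonal (tensor_map \<phi> \<phi> u)) = (\<lambda>u. \<phi> (diagonal u))"
    by (rule bounded_clinear_eq_on_ptens[OF
          bounded_clinear_compose[OF bounded_clinear_diagonal bounded_clinear_tensor_map[OF bdd bdd]]
          bounded_clinear_compose[OF bdd bounded_clinear_diagonal]])
      (simp add: tensor_map_ptens bdd diagonal_ptens mult)
  then show ?thesis by (rule fun_cong)
qed

section \<open>Biprojectivity and biflatness of retracts\<close>

lemma biprojective_retract:
  fixes \<phi> :: "'a :: complex_banach_algebra \<Rightarrow> 'b :: complex_banach_algebra"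
  assumes \<phi>: "continuous_algebra_hom \<phi>" and \<psi>: "continuous_algebra_hom \<psi>" and inv: "\<And>b. \<phi> (\<psi> b) = b"
    and A: "biprojective TYPE('a)"
  shows "biprojective TYPE('b)"
proof -
  obtain \<rho> :: "'a \<Rightarrow> ('a, 'a) ptensor" where \<rho>: "bimodule_hom (*) (*) tensor_left tensor_right \<rho>"
    and right_inverse: "\<And>a. diagonal (\<rho> a) = a"
    using A by (auto simp: biprojective_def)
  have "bimodule_hom (*) (*) tensor_left tensor_right (\<lambda>b. tensor_map \<phi> \<phi> (\<rho> (\<psi> b)))"
    by (rule bimodule_hom_compose[OF tensor_map_bimodule_hom[OF \<phi> inv]
        bimodule_hom_compose[OF bimodule_hom_restrict[OF \<rho>] algebra_hom_bimodule_hom[OF \<psi>]]])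
  then show ?thesis
    unfolding biprojective_def using diagonal_tensor_map[OF \<phi>] right_inverse inv
    by (intro exI[of _ "\<lambda>b. tensor_map \<phi> \<phi> (\<rho> (\<psi> b))"]) simp
qed

lemma biflat_retract:
  fixes \<phi> :: "'a :: complex_banach_algebra \<Rightarrow> 'b :: complex_banach_algebra"
  assumes \<phi>: "continuous_algebra_hom \<phi>" and \<psi>: "continuous_algebra_hom \<psi>" and inv: "\<And>b. \<phi> (\<psi> b) = b"
    and A: "biflat TYPE('a)"
  shows "biflat TYPE('b)"
proof -
  obtain \<Lambda> :: "('a, 'a) ptensor dual \<Rightarrow> 'a dual"
    where \<Lambda>: "bimodule_hom (dual_left tensor_right) (dual_right tensor_left) (dual_left (*)) (dual_right (*)) \<Lambda>"
      and left_inverse: "\<And>f. \<Lambda> (adjoint_map diagonal f) = f"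
    using A by (auto simp: biflat_def)
  note bdd = continuous_algebra_hom_bounded_clinear
  note tbdd = bounded_clinear_tensor_map[OF bdd[OF \<phi>] bdd[OF \<phi>]]
  let ?\<Lambda> = "\<lambda>F. adjoint_map \<psi> (\<Lambda> (adjoint_map (tensor_map \<phi> \<phi>) F))"
  \<comment> \<open>The dual of a restricted module is the restriction of the dual module.\<close>
  have restrict: "dual_left (\<lambda>x b. rX x (\<psi> b)) = (\<lambda>b. dual_left rX (\<psi> b))"
    "dual_right (\<lambda>b. lX (\<psi> b)) = (\<lambda>f b. dual_right lX f (\<psi> b))"
    for rX :: "'x :: complex_banach \<Rightarrow> 'a \<Rightarrow> 'x" and lX
    by (simp_all add: dual_left_def dual_right_def fun_eq_iff)
  have tensor: "bimodule_hom (dual_left tensor_right) (dual_right tensor_left)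
      (\<lambda>b. dual_left tensor_right (\<psi> b)) (\<lambda>f b. dual_right tensor_left f (\<psi> b))
      (adjoint_map (tensor_map \<phi> \<phi>))"
    using bimodule_hom_adjoint_map[OF tensor_map_bimodule_hom[OF \<phi> inv]]
    by (simp add: restrict bounded_clinear_tensor_left bounded_clinear_tensor_right)
  have restriction: "bimodule_hom (\<lambda>b. dual_left (*) (\<psi> b)) (\<lambda>f b. dual_right (*) f (\<psi> b))
      (dual_left (*)) (dual_right (*)) (adjoint_map \<psi>)"
    using bimodule_hom_adjoint_map[OF algebra_hom_bimodule_hom[OF \<psi>]]
    by (simp add: restrict bounded_clinear_mult_left bounded_clinear_mult_right)
  have "bimodule_hom (dual_left tensor_right) (dual_right tensor_left) (dual_left (*)) (dual_right (*)) ?\<Lambda>"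
    by (rule bimodule_hom_compose[OF restriction bimodule_hom_compose[OF bimodule_hom_restrict[OF \<Lambda>] tensor]])
  moreover have "?\<Lambda> (adjoint_map diagonal f) = f" for f
  proof -
    have "adjoint_map (tensor_map \<phi> \<phi>) (adjoint_map diagonal f) = adjoint_map diagonal (adjoint_map \<phi> f)"
      by (simp add: adjoint_map_compose tbdd bdd[OF \<phi>] bounded_clinear_diagonal diagonal_tensor_map[OF \<phi>])
    then show ?thesis
      by (simp add: left_inverse adjoint_map_compose bdd[OF \<phi>] bdd[OF \<psi>] inv adjoint_map_id)
  qed
  ultimately show ?thesis unfolding biflat_def by blast
qed

section \<open>Contractibility of homomorphic images\<close>

definition restrict_bimodule :: "('a \<Rightarrow> 'b) \<Rightarrow> ('b, 'e) bimodule \<Rightarrow> ('a, 'e) bimodule" where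
  "restrict_bimodule \<phi> E =
     \<lparr>bm_carrier = bm_carrier E, bm_zero = bm_zero E, bm_add = bm_add E, bm_scale = bm_scale E,
      bm_norm = bm_norm E, bm_left = (\<lambda>a. bm_left E (\<phi> a)), bm_right = (\<lambda>x a. bm_right E x (\<phi> a))\<rparr>"

lemma restrict_bimodule_simps [simp]:
  "bm_carrier (restrict_bimodule \<phi> E) = bm_carrier E"
  "bm_zero (restrict_bimodule \<phi> E) = bm_zero E"
  "bm_add (restrict_bimodule \<phi> E) = bm_add E"
  "bm_scale (restrict_bimodule \<phi> E) = bm_scale E"
  "bm_norm (restrict_bimodule \<phi> E) = bm_norm E"
  "bm_left (restrict_bimodule \<phi> E) a x = bm_left E (\<phi> a) x"
  "bm_right (restrict_bimodule \<phi> E) x a = bm_right E x (\<phi> a)"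
  "bm_diff (restrict_bimodule \<phi> E) x y = bm_diff E x y"
  by (simp_all add: restrict_bimodule_def bm_diff_def)

lemma banach_bimodule_restrict:
  assumes \<phi>: "continuous_algebra_hom \<phi>" and "banach_bimodule E"
  shows "banach_bimodule (restrict_bimodule \<phi> E)"
proof -
  interpret banach_bimodule E by fact
  have hom: "\<phi> (a + b) = \<phi> a + \<phi> b" "\<phi> (c *\<^sub>C a) = c *\<^sub>C \<phi> a" "\<phi> (a * b) = \<phi> a * \<phi> b" for a b c
    using \<phi> by (auto simp: continuous_algebra_hom_def)
  obtain C where C: "\<And>a. norm (\<phi> a) \<le> norm a * C"
    using continuous_algebra_hom_bounded_clinear[OF \<phi>] bounded_linear.bounded[of \<phi>]
    unfolding bounded_clinear_def by blast
  have bound: "N y \<le> (K * C) * norm a * N x"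
    if "K \<ge> 0" "N y \<le> K * norm (\<phi> a) * N x" "x \<in> M" for K a x y
  proof -
    have "K * norm (\<phi> a) * N x \<le> K * (norm a * C) * N x"
      using that C norm_ge0 by (intro mult_right_mono mult_left_mono) auto
    then show ?thesis using that(2) by (simp add: mult_ac)
  qed
  show ?thesis
  proof (unfold_locales, unfold restrict_bimodule_simps)
    fix X :: "nat \<Rightarrow> _"
    assume "\<forall>n. X n \<in> M" "\<forall>e>0. \<exists>K. \<forall>m\<ge>K. \<forall>n\<ge>K. d (X m) (X n) < e"
    then show "\<exists>x\<in>M. (\<lambda>n. d (X n) x) \<longlonglongrightarrow> 0" by (rule complete)
  next
    obtain K where "K \<ge> 0" "\<And>b x. x \<in> M \<Longrightarrow> N (b \<rightharpoonup> x) \<le> K * norm b * N x" using left_bound by blast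
    then show "\<exists>K. \<forall>a. \<forall>x\<in>M. N (\<phi> a \<rightharpoonup> x) \<le> K * norm a * N x" using bound by blast
  next
    obtain K where "K \<ge> 0" "\<And>b x. x \<in> M \<Longrightarrow> N (x \<leftharpoonup> b) \<le> K * norm b * N x" using right_bound by blast
    then show "\<exists>K. \<forall>a. \<forall>x\<in>M. N (x \<leftharpoonup> \<phi> a) \<le> K * norm a * N x" using bound by blast
  qed (simp_all add: hom closed add_assoc add_zero diff_self scale_add_right scale_add_left
      scale_scale scale_one norm_eq_zero norm_triangle norm_scale left_add_right left_add_left
      left_scale_right left_scale_left right_add_left right_add_right right_scale_left
      right_scale_right left_left right_right left_right, rule add_commute)
qed

lemma derivation_restrict:
  assumes \<phi>: "continuous_algebra_hom \<phi>" and D: "derivation E D"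
  shows "derivation (restrict_bimodule \<phi> E) (\<lambda>a. D (\<phi> a))"
proof -
  obtain K where K: "\<And>b. bm_norm E (D b) \<le> K * norm b" using D by (auto simp: derivation_def)
  obtain C where C: "\<And>a. norm (\<phi> a) \<le> norm a * C"
    using continuous_algebra_hom_bounded_clinear[OF \<phi>] bounded_linear.bounded[of \<phi>]
    unfolding bounded_clinear_def by blast
  have "bm_norm E (D (\<phi> a)) \<le> (\<bar>K\<bar> * C) * norm a" for a
  proof -
    have "bm_norm E (D (\<phi> a)) \<le> \<bar>K\<bar> * norm (\<phi> a)"
      using K[of "\<phi> a"] by (rule order_trans) (simp add: mult_right_mono)
    also have "\<dots> \<le> \<bar>K\<bar> * (norm a * C)" by (intro mult_left_mono C) simp
    finally show ?thesis by (simp add: mult_ac)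
  qed
  then have "\<exists>L. \<forall>a. bm_norm E (D (\<phi> a)) \<le> L * norm a" by blast
  then show ?thesis using \<phi> D by (simp add: derivation_def continuous_algebra_hom_def)
qed

text \<open>The bimodules that test \<open>B\<close> live on a type built from \<open>B\<close>, not on the one that tests \<open>A\<close>;
  \<open>contractible_algebraD\<close> bridges the gap.\<close>

lemma contractible_surjective_image:
  fixes \<phi> :: "'a :: complex_banach_algebra \<Rightarrow> 'b :: complex_banach_algebra"
  assumes \<phi>: "continuous_algebra_hom \<phi>" and surj: "surj \<phi>" and A: "contractible_algebra TYPE('a)"
  shows "contractible_algebra TYPE('b)"
  unfolding contractible_algebra_def
proof (intro allI impI, elim conjE)
  fix E :: "('b, nat \<Rightarrow> 'b \<times> ('b \<times> 'b) list) bimodule" and D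
  assume E: "banach_bimodule E" and D: "derivation E D"
  have "inner_derivation (restrict_bimodule \<phi> E) (\<lambda>a. D (\<phi> a))"
    using A banach_bimodule_restrict[OF \<phi> E] derivation_restrict[OF \<phi> D] by (rule contractible_algebraD)
  then obtain z where "z \<in> bm_carrier E" "\<And>a. D (\<phi> a) = bm_diff E (bm_right E z (\<phi> a)) (bm_left E (\<phi> a) z)"
    by (auto simp: inner_derivation_def)
  then show "inner_derivation E D" unfolding inner_derivation_def using surj by (metis surjD)
qed

theorem theorem2p3:
  fixes \<phi> :: "'a :: complex_banach_algebra \<Rightarrow> 'b :: complex_banach_algebra"
  assumes "algebra_retraction \<phi>"
  shows "(biprojective TYPE('a) \<longrightarrow> biprojective TYPE('b)) \<and>
    (contractible_algebra TYPE('a) \<longrightarrow> contractible_algebra TYPE('b)) \<and>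
    (biflat TYPE('a) \<longrightarrow> biflat TYPE('b))"
proof -
  obtain \<psi> where \<phi>: "continuous_algebra_hom \<phi>" and \<psi>: "continuous_algebra_hom \<psi>" and "\<phi> \<circ> \<psi> = id"
    using assms by (auto simp: algebra_retraction_def)
  then have inv: "\<phi> (\<psi> b) = b" for b by (simp add: fun_eq_iff)
  then have "surj \<phi>" by (rule surjI)
  then show ?thesis
    using biprojective_retract[OF \<phi> \<psi> inv] contractible_surjective_image[OF \<phi>] biflat_retract[OF \<phi> \<psi> inv]
    by blast
qed

end
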